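(* Let $n\ge1$, $\delta>0$ and $\beta<n+4$. Assume that $\epsilon_1>0$ and $b\in H^s(T^n)$ for some $s\in\mathbb{R}$, and for $t\ge0$ set $$U(t)=\hat b_0t+\sum_{0\ne k\in\mathbb{Z}^n}\frac{e^{m(\nu_k)t}-1}{m(\nu_k)}\hat b_k e^{i\nu_k\cdot x},\qquad V(t)=\sum_{k\in\mathbb{Z}^n}e^{m(\nu_k)t}\hat b_k e^{i\nu_k\cdot x}.$$ Then for any fixed $t>0$, $U(t)\in H^p(T^n)$ and $V(t)\in H^r(T^n)$, where $$p=\begin{cases}s,&\beta\le n,\\ s+\beta-n,&\beta>n,\end{cases}\qquad r=\begin{cases}s,&\beta<n,\\ s+\dfrac{4nt}{\delta^2}(1-\epsilon_1),&\beta=n,\\ \infty,&\beta>n.\end{cases}$$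
   Context: Let $r_1,\dots,r_n>0$ and let $T^n=\prod_{i=1}^n[0,r_i]$ be the periodic torus (opposite faces identified). For $k\in\mathbb{Z}^n$ put $\nu_k=\left(\frac{2\pi k_1}{r_1},\dots,\frac{2\pi k_n}{r_n}\right)$. A periodic distribution $h$ on $T^n$ is written through its Fourier coefficients as $h=\sum_{k\in\mathbb{Z}^n}\hat h_k e^{i\nu_k\cdot x}$. For $s\in\mathbb{R}$, $H^s(T^n)$ is the space of periodic distributions with $\|h\|_{H^s(T^n)}^2:=\sum_{k\in\mathbb{Z}^n}(1+\|k\|^2)^s|\hat h_k|^2<\infty$, and $H^\infty(T^n):=\bigcap_{s\in\mathbb{R}}H^s(T^n)$. For $n\ge1$, $\delta>0$, $\beta<n+4$, the Fourier multiplier is $$m(\nu)=m^{\delta,\beta}(\nu)=-\|\nu\|^2\;{}_2F_3\!\left(1,\tfrac{n+2-\beta}{2};\,2,\tfrac{n+2}{2},\tfrac{n+4-\beta}{2};\,-\tfrac14\|\nu\|^2\delta^2\right),\quad \nu\in\mathbb{R}^n.$$ For $\beta<n+2$ it equals $c^{\delta,\beta}\int_{B_\delta(0)}\frac{\cos(\nu\cdot z)-1}{\|z\|^\beta}dz$ with $c^{\delta,\beta}=\frac{2(n+2-\beta)\Gamma(\frac n2+1)}{\pi^{n/2}\delta^{n+2-\beta}}$; for $\beta=n+2$ it equals $-\|\nu\|^2$. *)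

theory Defs
  imports "HOL-Analysis.Analysis"
begin

text \<open>
  The dimension is the cardinality of the index type \<open>'n\<close>. The vector \<open>r\<close> contains the
  periods, and functions on the torus are the \<open>r\<close>-periodic functions on \<open>real ^ 'n\<close>.
  Periodic distributions are continuous linear functionals on the smooth functions on the torus.
\<close>

definition partial_deriv :: "'n \<Rightarrow> (real ^ 'n \<Rightarrow> complex) \<Rightarrow> real ^ 'n \<Rightarrow> complex" where
  "partial_deriv i f x = frechet_derivative f (at x) (axis i 1)"

definition iter_partial :: "'n list \<Rightarrow> (real ^ 'n \<Rightarrow> complex) \<Rightarrow> real ^ 'n \<Rightarrow> complex" where
  "iter_partial js f = foldr partial_deriv js f"

definition test_functions :: "real ^ 'n \<Rightarrow> (real ^ 'n \<Rightarrow> complex) set" where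
  "test_functions r = {\<phi>. (\<forall>js. iter_partial js \<phi> differentiable_on UNIV) \<and>
     (\<forall>i x. \<phi> (x + (r $ i) *\<^sub>R axis i 1) = \<phi> x)}"

text \<open>
  Continuity is expressed by the seminorms that define the Frechet topology of the space of test
  functions. Functionals are total functions; their values outside the test functions are
  irrelevant.
\<close>

definition periodic_distribution ::
    "real ^ 'n \<Rightarrow> ((real ^ 'n \<Rightarrow> complex) \<Rightarrow> complex) \<Rightarrow> bool" where
  "periodic_distribution r h \<longleftrightarrow>
     (\<forall>\<phi>\<in>test_functions r. \<forall>\<psi>\<in>test_functions r. h (\<lambda>x. \<phi> x + \<psi> x) = h \<phi> + h \<psi>) \<and>
     (\<forall>\<phi>\<in>test_functions r. \<forall>c. h (\<lambda>x. c * \<phi> x) = c * h \<phi>) \<and>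
     (\<exists>C N. \<forall>\<phi>\<in>test_functions r.
        cmod (h \<phi>) \<le> C * (\<Sum>js | length js \<le> N. SUP x\<in>cbox 0 r. cmod (iter_partial js \<phi> x)))"

definition freq :: "real ^ 'n \<Rightarrow> int ^ 'n \<Rightarrow> real ^ 'n" where
  "freq r k = (\<chi> i. 2 * pi * of_int (k $ i) / r $ i)"

definition mode :: "real ^ 'n \<Rightarrow> int ^ 'n \<Rightarrow> real ^ 'n \<Rightarrow> complex" where
  "mode r k x = exp (\<i> * complex_of_real (freq r k \<bullet> x))"

text \<open>
  A function \<open>f\<close> acts on test functions by integration of \<open>f x * \<phi> x\<close>, without conjugation.
  So the coefficient of \<open>h\<close> at \<open>mode r k\<close> is obtained by testing with \<open>mode r (- k)\<close>.
\<close>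

definition fourier_coeff ::
    "real ^ 'n \<Rightarrow> ((real ^ 'n \<Rightarrow> complex) \<Rightarrow> complex) \<Rightarrow> int ^ 'n \<Rightarrow> complex" where
  "fourier_coeff r h k = h (mode r (- k)) / complex_of_real (\<Prod>i\<in>UNIV. r $ i)"

definition mode_pairing :: "real ^ 'n \<Rightarrow> int ^ 'n \<Rightarrow> (real ^ 'n \<Rightarrow> complex) \<Rightarrow> complex" where
  "mode_pairing r k \<phi> = integral (cbox 0 r) (\<lambda>x. mode r k x * \<phi> x)"

text \<open>
  The Fourier series with coefficients \<open>c\<close>, summed in the sense of distributions. The value is
  only meaningful if the series converges.
\<close>

definition fourier_series_converges :: "real ^ 'n \<Rightarrow> (int ^ 'n \<Rightarrow> complex) \<Rightarrow> bool" where
  "fourier_series_converges r c \<longleftrightarrow>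
     (\<forall>\<phi>\<in>test_functions r. (\<lambda>k. c k * mode_pairing r k \<phi>) summable_on UNIV)"

definition fourier_series ::
    "real ^ 'n \<Rightarrow> (int ^ 'n \<Rightarrow> complex) \<Rightarrow> (real ^ 'n \<Rightarrow> complex) \<Rightarrow> complex" where
  "fourier_series r c \<phi> = (\<Sum>\<^sub>\<infinity>k. c k * mode_pairing r k \<phi>)"

definition sobolev :: "real ^ 'n \<Rightarrow> real \<Rightarrow> ((real ^ 'n \<Rightarrow> complex) \<Rightarrow> complex) set" where
  "sobolev r s = {h. periodic_distribution r h \<and>
     (\<lambda>k :: int ^ 'n. (1 + (norm (\<chi> i. real_of_int (k $ i)))\<^sup>2) powr s *
        (cmod (fourier_coeff r h k))\<^sup>2) summable_on UNIV}"

definition sobolev_infinity :: "real ^ 'n \<Rightarrow> ((real ^ 'n \<Rightarrow> complex) \<Rightarrow> complex) set" where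
  "sobolev_infinity r = (\<Inter>s. sobolev r s)"

definition multiplier :: "real \<Rightarrow> real \<Rightarrow> real ^ 'n \<Rightarrow> real" where
  "multiplier \<delta> \<beta> \<nu> = (let n = real CARD('n) in
     - (norm \<nu>)\<^sup>2 *
       eval_fps (fps_hypergeo [1, (n + 2 - \<beta>) / 2] [2, (n + 2) / 2, (n + 4 - \<beta>) / 2] 1)
         (- (1 / 4) * (norm \<nu>)\<^sup>2 * \<delta>\<^sup>2))"

definition U_coeff :: "real ^ 'n \<Rightarrow> real \<Rightarrow> real \<Rightarrow> ((real ^ 'n \<Rightarrow> complex) \<Rightarrow> complex) \<Rightarrow>
    real \<Rightarrow> int ^ 'n \<Rightarrow> complex" where
  "U_coeff r \<delta> \<beta> b t k =
     (if k = 0 then fourier_coeff r b 0 * complex_of_real t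
      else complex_of_real
        ((exp (multiplier \<delta> \<beta> (freq r k) * t) - 1) / multiplier \<delta> \<beta> (freq r k))
        * fourier_coeff r b k)"

definition V_coeff :: "real ^ 'n \<Rightarrow> real \<Rightarrow> real \<Rightarrow> ((real ^ 'n \<Rightarrow> complex) \<Rightarrow> complex) \<Rightarrow>
    real \<Rightarrow> int ^ 'n \<Rightarrow> complex" where
  "V_coeff r \<delta> \<beta> b t k =
     complex_of_real (exp (multiplier \<delta> \<beta> (freq r k) * t)) * fourier_coeff r b k"

end

theory Submission
  imports Defs
begin

text \<open>
  Write \<open>c = n / 2\<close>, \<open>a = (n + 2 - \<beta>) / 2\<close> and \<open>z = \<parallel>\<nu>\<parallel>\<^sup>2 \<delta>\<^sup>2 / 4\<close>. Since \<open>(a)\<^sub>k / (a + 1)\<^sub>k = a / (a + k)\<close>, the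
  multiplier is \<open>- (4 / \<delta>\<^sup>2) g z\<close> with \<open>z g' + (a - 1) g = a c (1 - \<phi>)\<close>, where \<open>\<phi> z\<close> is the
  hypergeometric function \<open>0F1(; c; - z)\<close>. The equation \<open>z \<phi>'' + c \<phi>' + \<phi> = 0\<close> makes \<open>z \<phi>'\<^sup>2 + \<phi>\<^sup>2\<close>
  nonincreasing, which bounds \<open>\<phi>\<close> and \<open>\<phi>'\<close> without any Bessel asymptotics. Therefore
  \<open>z powr (a - 1) * g z\<close> (for \<open>a \<ge> 0\<close>) or \<open>z powr (a - 1) * (g z - z)\<close> (for \<open>a < 0\<close>) is nondecreasing,
  so \<open>g\<close> grows at least like \<open>z powr (1 - a)\<close>; for \<open>a = 1\<close> the growth is at least \<open>c ln z\<close>.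

  On the Fourier side, a multiplier of size \<open>O((1 + \<parallel>k\<parallel>\<^sup>2) powr (- p))\<close> gains \<open>2 p\<close> derivatives. The
  resulting series converge as distributions because the pairings of a test function with the
  modes decay rapidly. Both this decay and the orthogonality of the modes come from the
  invariance of the integral of a periodic function over a period cell under translations.
\<close>

section \<open>Growth of the symbol\<close>

lemma fps_conv_radius_eq_inf:
  fixes f :: "real fps"
  assumes "\<And>k. \<bar>fps_nth f k\<bar> \<le> C / fact k"
  shows "fps_conv_radius f = \<infinity>"
  unfolding fps_conv_radius_def
proof (rule conv_radius_inftyI'[of 0])
  fix r :: real
  show "\<exists>z. norm z = r \<and> summable (\<lambda>n. fps_nth f n * z ^ n)" if "r > 0"
  proof (intro exI conjI)
    show "norm r = r" using that by simp
    have "summable (\<lambda>n. C * (r ^ n /\<^sub>R fact n))"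
      using summable_exp_generic[of r] by (intro summable_mult)
    then show "summable (\<lambda>n. fps_nth f n * r ^ n)"
    proof (rule summable_comparison_test_ev[rotated])
      have "norm (fps_nth f n * r ^ n) \<le> C * (r ^ n /\<^sub>R fact n)" for n
        using mult_right_mono[OF assms, of "r ^ n" n] that by (simp add: abs_mult field_simps)
      then show "\<forall>\<^sub>F n in sequentially. norm (fps_nth f n * r ^ n) \<le> C * (r ^ n /\<^sub>R fact n)"
        by simp
    qed
  qed
qed

lemma pochhammer_ge_1:
  fixes x :: real
  assumes "x \<ge> 1"
  shows "pochhammer x k \<ge> 1"
  unfolding pochhammer_prod using assms by (intro prod_ge_1) auto

lemma pochhammer_mult_add:
  fixes a :: real
  shows "pochhammer a k * (a + real k) = a * pochhammer (a + 1) k"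
  using pochhammer_rec[of a k] pochhammer_rec'[of a k] by (simp add: mult.commute)

text \<open>In terms of the Bessel function J, the sum at z > 0 is Gamma(c) z^((1 - c)/2) J_(c -
  1)(2 sqrt z).\<close>

definition bessel_fps :: "real \<Rightarrow> real fps" where
  "bessel_fps c = Abs_fps (\<lambda>k. (- 1) ^ k / (fact k * pochhammer c k))"

text \<open>The quotient of Pochhammer symbols is not shortened to \<open>a / (a + k)\<close>: for
  \<open>a = 0\<close> (that is, \<beta> = n + 2) the constant coefficient must be 1, whereas
  \<open>0 / 0\<close> is 0.\<close>

definition symbol_fps :: "real \<Rightarrow> real \<Rightarrow> real fps" where
  "symbol_fps a c = Abs_fps (\<lambda>k. pochhammer a k / pochhammer (a + 1) k *
     (- 1) ^ k / (fact (Suc k) * pochhammer (c + 1) k))"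

definition bessel :: "real \<Rightarrow> real \<Rightarrow> real" where
  "bessel c = eval_fps (bessel_fps c)"

definition bessel' :: "real \<Rightarrow> real \<Rightarrow> real" where
  "bessel' c = eval_fps (fps_deriv (bessel_fps c))"

definition bessel'' :: "real \<Rightarrow> real \<Rightarrow> real" where
  "bessel'' c = eval_fps (fps_deriv (fps_deriv (bessel_fps c)))"

definition symbol :: "real \<Rightarrow> real \<Rightarrow> real \<Rightarrow> real" where
  "symbol a c = eval_fps (fps_X * symbol_fps a c)"

definition symbol' :: "real \<Rightarrow> real \<Rightarrow> real \<Rightarrow> real" where
  "symbol' a c = eval_fps (fps_deriv (fps_X * symbol_fps a c))"

text \<open>For \<open>c < 1\<close>, which occurs in dimension one, \<open>pochhammer c k\<close>
  can be below 1; splitting off the first factor still gives at least \<open>c\<close>. The summand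
  1 in the constant covers \<open>k = 0\<close>.\<close>

lemma conv_radius_bessel_fps:
  assumes "c > 0"
  shows "fps_conv_radius (bessel_fps c) = \<infinity>"
proof (rule fps_conv_radius_eq_inf)
  fix k
  have "1 / pochhammer c k \<le> 1 + 1 / c"
  proof (cases k)
    case (Suc j)
    have "pochhammer c k \<ge> c * 1"
      using mult_left_mono[OF pochhammer_ge_1[of "c + 1" j], of c] assms Suc
      by (simp add: pochhammer_rec)
    then have "1 / pochhammer c k \<le> 1 / c"
      using assms by (intro divide_left_mono) (auto intro!: mult_pos_pos)
    then show ?thesis by simp
  qed (use assms in simp)
  moreover have "pochhammer c k > 0"
    using assms by (rule pochhammer_pos)
  ultimately show "\<bar>fps_nth (bessel_fps c) k\<bar> \<le> (1 + 1 / c) / fact k"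
    by (simp add: bessel_fps_def abs_mult power_abs divide_simps)
qed

lemma conv_radius_symbol_fps:
  assumes "c > 0" "a > - 1"
  shows "fps_conv_radius (symbol_fps a c) = \<infinity>"
proof (rule fps_conv_radius_eq_inf)
  fix k
  have p: "pochhammer (a + 1) k > 0"
    using assms by (intro pochhammer_pos) simp
  have "\<bar>pochhammer a k / pochhammer (a + 1) k\<bar> \<le> 1 + \<bar>a\<bar> / (a + 1)"
  proof (cases "k = 0")
    case False
    then have "a + real k \<ge> a + 1" "a + real k > 0" using assms by auto
    moreover have "pochhammer a k / pochhammer (a + 1) k = a / (a + real k)"
      using pochhammer_mult_add[of a k] p \<open>a + real k > 0\<close> by (simp add: field_simps)
    ultimately have "\<bar>pochhammer a k / pochhammer (a + 1) k\<bar> \<le> \<bar>a\<bar> / (a + 1)"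
      using assms by (simp add: abs_divide frac_le)
    then show ?thesis by simp
  qed (use assms in simp)
  moreover have "fact (Suc k) * pochhammer (c + 1) k \<ge> fact k * 1"
    using assms pochhammer_ge_1[of "c + 1" k] by (intro mult_mono fact_mono) auto
  ultimately have "\<bar>pochhammer a k / pochhammer (a + 1) k\<bar> / (fact (Suc k) * pochhammer (c + 1) k)
      \<le> (1 + \<bar>a\<bar> / (a + 1)) / (fact k * 1)"
    using assms by (intro frac_le) (auto simp: add_nonneg_nonneg)
  moreover have "pochhammer (c + 1) k > 0"
    using assms by (intro pochhammer_pos) auto
  ultimately show "\<bar>fps_nth (symbol_fps a c) k\<bar> \<le> (1 + \<bar>a\<bar> / (a + 1)) / fact k"
    by (simp add: symbol_fps_def abs_mult abs_divide power_abs)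
qed

lemma conv_radius_deriv_inf:
  fixes f :: "real fps"
  assumes "fps_conv_radius f = \<infinity>"
  shows "fps_conv_radius (fps_deriv f) = \<infinity>"
  using fps_conv_radius_deriv[of f] assms by simp

lemma conv_radius_mult_inf:
  fixes f g :: "real fps"
  assumes "fps_conv_radius f = \<infinity>" "fps_conv_radius g = \<infinity>"
  shows "fps_conv_radius (f * g) = \<infinity>"
  using fps_conv_radius_mult[of f g] assms by simp

lemma conv_radius_add_inf:
  fixes f g :: "real fps"
  assumes "fps_conv_radius f = \<infinity>" "fps_conv_radius g = \<infinity>"
  shows "fps_conv_radius (f + g) = \<infinity>"
  using fps_conv_radius_add[of f g] assms by simp

lemma bessel_deriv:
  assumes "c > 0"
  shows "(bessel c has_real_derivative bessel' c z) (at z)"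
    and "(bessel' c has_real_derivative bessel'' c z) (at z)"
  unfolding bessel_def bessel'_def bessel''_def
  using conv_radius_bessel_fps[OF assms]
  by (auto intro!: has_field_derivative_eval_fps simp: conv_radius_deriv_inf)

lemma symbol_deriv:
  assumes "c > 0" "a > - 1"
  shows "(symbol a c has_real_derivative symbol' a c z) (at z)"
  unfolding symbol_def symbol'_def
  using conv_radius_symbol_fps[OF assms]
  by (intro has_field_derivative_eval_fps) (simp add: conv_radius_mult_inf)

lemma bessel_0: "bessel c 0 = 1"
  by (simp add: bessel_def eval_fps_at_0 bessel_fps_def)

text \<open>Coefficientwise this is the recursion
  \<open>(c + k) * (k + 1) * f (k + 1) + f k = 0\<close>.\<close>

lemma bessel_ode:
  assumes "c > 0"
  shows "z * bessel'' c z + c * bessel' c z + bessel c z = 0"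
proof -
  let ?f = "bessel_fps c"
  note R = conv_radius_bessel_fps[OF assms] conv_radius_deriv_inf conv_radius_mult_inf
    conv_radius_add_inf
  have "fps_X * fps_deriv (fps_deriv ?f) + fps_const c * fps_deriv ?f + ?f = 0"
  proof (rule fps_ext)
    fix k
    have nz: "pochhammer c k \<noteq> 0" "c + real k \<noteq> 0"
      using assms pochhammer_pos[of c k] by auto
    have "fps_nth (fps_X * fps_deriv (fps_deriv ?f)) k =
        real k * real (Suc k) * fps_nth ?f (Suc k)"
      by (cases k) (auto simp: algebra_simps)
    then have "fps_nth (fps_X * fps_deriv (fps_deriv ?f) + fps_const c * fps_deriv ?f + ?f) k
        = (c + real k) * (real (Suc k) * fps_nth ?f (Suc k)) + fps_nth ?f k"
      by (simp add: algebra_simps)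
    also have "\<dots> = 0"
      using nz by (simp add: bessel_fps_def pochhammer_rec' divide_simps del: of_nat_Suc)
    finally show "fps_nth (fps_X * fps_deriv (fps_deriv ?f) + fps_const c * fps_deriv ?f + ?f) k
        = fps_nth 0 k" by simp
  qed
  from arg_cong[OF this, of "\<lambda>f. eval_fps f z"] show ?thesis
    by (simp add: eval_fps_add eval_fps_mult R bessel_def bessel'_def bessel''_def)
qed

text \<open>On the coefficient of order \<open>j + 1\<close> the operator acts as multiplication by
  \<open>a + j\<close>, which cancels the denominator in a / (a + j). What remains is a multiple of
  the Bessel coefficient of order \<open>j + 1\<close>.\<close>

lemma symbol_ode:
  assumes "c > 0" "a > - 1"
  shows "z * symbol' a c z + (a - 1) * symbol a c z = a * c * (1 - bessel c z)"
proof -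
  let ?g = "fps_X * symbol_fps a c" and ?f = "bessel_fps c"
  note R = conv_radius_bessel_fps[OF assms(1)] conv_radius_symbol_fps[OF assms]
    conv_radius_deriv_inf conv_radius_mult_inf conv_radius_add_inf
  have "fps_X * fps_deriv ?g + fps_const (a - 1) * ?g + fps_const (a * c) * ?f = fps_const (a * c)"
  proof (rule fps_ext)
    fix k
    show "fps_nth (fps_X * fps_deriv ?g + fps_const (a - 1) * ?g + fps_const (a * c) * ?f) k
        = fps_nth (fps_const (a * c)) k"
    proof (cases k)
      case (Suc j)
      let ?p = "fact (Suc j) * pochhammer (c + 1) j :: real"
      have nz: "?p \<noteq> 0" "pochhammer (a + 1) j \<noteq> 0"
        using assms pochhammer_pos[of "c + 1" j] pochhammer_pos[of "a + 1" j] by auto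
      have "fps_nth (fps_X * fps_deriv ?g + fps_const (a - 1) * ?g + fps_const (a * c) * ?f) k
          = (a + real j) * fps_nth (symbol_fps a c) j + a * c * fps_nth ?f (Suc j)"
        unfolding Suc by (simp add: algebra_simps)
      also have "(a + real j) * fps_nth (symbol_fps a c) j
          = (pochhammer a j * (a + real j)) / pochhammer (a + 1) j * (- 1) ^ j / ?p"
        by (simp add: symbol_fps_def)
      also have "\<dots> = a * (- 1) ^ j / ?p"
        using nz by (simp add: pochhammer_mult_add)
      also have "a * c * fps_nth ?f (Suc j) = - (a * (- 1) ^ j / ?p)"
        using assms by (simp add: bessel_fps_def pochhammer_rec)
      finally show ?thesis using Suc by simp
    qed (simp add: bessel_fps_def)
  qed
  from arg_cong[OF this, of "\<lambda>f. eval_fps f z"] show ?thesis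
    by (simp add: eval_fps_add eval_fps_mult R bessel_def symbol_def symbol'_def algebra_simps)
qed

text \<open>Since (1)_k = k! and (2)_k = (k + 1)!, the hypergeometric coefficients at
  \<open>- z\<close> are those of \<open>symbol_fps\<close> at \<open>z\<close>; the prefactor is 4
  z / \<delta>^2, and its \<open>z\<close> becomes the \<open>fps_X\<close> in
  \<open>symbol\<close>.\<close>

lemma multiplier_eq_symbol:
  fixes \<nu> :: "real ^ 'n"
  assumes "\<delta> > 0" "\<beta> < real CARD('n) + 4"
  shows "multiplier \<delta> \<beta> \<nu> = - (4 / \<delta>\<^sup>2) *
    symbol ((real CARD('n) + 2 - \<beta>) / 2) (real CARD('n) / 2) ((norm \<nu>)\<^sup>2 * \<delta>\<^sup>2 / 4)"
proof -
  define a where "a = (real CARD('n) + 2 - \<beta>) / 2"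
  define c where "c = real CARD('n) / 2"
  define z where "z = (norm \<nu>)\<^sup>2 * \<delta>\<^sup>2 / 4"
  have "c > 0" "a > - 1" using assms by (auto simp: a_def c_def)
  have eqs: "(real CARD('n) + 2) / 2 = c + 1" "(real CARD('n) + 4 - \<beta>) / 2 = a + 1"
      "- (1 / 4) * (norm \<nu>)\<^sup>2 * \<delta>\<^sup>2 = - z"
    by (simp_all add: a_def c_def z_def field_simps)
  then have "multiplier \<delta> \<beta> \<nu> =
      - (norm \<nu>)\<^sup>2 * eval_fps (fps_hypergeo [1, a] [2, c + 1, a + 1] 1) (- z)"
    unfolding multiplier_def Let_def eqs by (simp only: a_def)
  also have "eval_fps (fps_hypergeo [1, a] [2, c + 1, a + 1] 1) (- z) = eval_fps (symbol_fps a c) z"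
  proof -
    have "pochhammer 2 k = (fact (Suc k) :: real)" for k
      using pochhammer_rec[of "1 :: real" k] by (simp flip: pochhammer_fact)
    then show ?thesis
      unfolding eval_fps_def
      by (intro suminf_cong) (simp add: symbol_fps_def pochhammer_fact[symmetric] power_minus[of z] mult_ac del: fact_Suc)
  qed
  also have "- (norm \<nu>)\<^sup>2 * eval_fps (symbol_fps a c) z = - (4 / \<delta>\<^sup>2) * symbol a c z"
    using assms \<open>c > 0\<close> \<open>a > - 1\<close> by (simp add: symbol_def eval_fps_mult conv_radius_symbol_fps z_def)
  finally show ?thesis by (simp add: a_def c_def z_def)
qed

section \<open>Bounds for the Bessel-type function\<close>

text \<open>By the equation the derivative of the energy is
  \<open>- (2 * c - 1) * (bessel' c w)\<^sup>2\<close>, and \<open>c \<ge> 1 / 2\<close> is exactly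
  dimension at least one. For \<open>c = 1 / 2\<close> the energy is cos^2 + sin^2 at 2 sqrt
  z.\<close>

lemma bessel_energy:
  assumes "c \<ge> 1 / 2" "z \<ge> 0"
  shows "z * (bessel' c z)\<^sup>2 + (bessel c z)\<^sup>2 \<le> 1"
proof -
  have c: "c > 0" using assms by simp
  let ?E = "\<lambda>z. z * (bessel' c z)\<^sup>2 + (bessel c z)\<^sup>2"
  have "?E z \<le> ?E 0"
  proof (rule DERIV_nonpos_imp_nonincreasing[OF assms(2)])
    fix w :: real
    let ?b = "bessel c w" and ?b' = "bessel' c w" and ?b'' = "bessel'' c w"
    have "w * ?b'' + ?b = - c * ?b'"
      using bessel_ode[OF c, of w] by simp
    then have "?b'\<^sup>2 + 2 * ?b' * (w * ?b'' + ?b) = - (2 * c - 1) * ?b'\<^sup>2"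
      by (simp add: algebra_simps power2_eq_square)
    moreover have "- (2 * c - 1) * ?b'\<^sup>2 \<le> 0"
      using assms by (intro mult_nonpos_nonneg) auto
    moreover have "(?E has_real_derivative ?b'\<^sup>2 + 2 * ?b' * (w * ?b'' + ?b)) (at w)"
      by (auto intro!: derivative_eq_intros bessel_deriv[OF c] simp: algebra_simps power2_eq_square)
    ultimately show "\<exists>y. (?E has_real_derivative y) (at w) \<and> y \<le> 0" by metis
  qed
  then show ?thesis by (simp add: bessel_0)
qed

lemma bessel_le_1:
  assumes "c \<ge> 1 / 2" "z \<ge> 0"
  shows "\<bar>bessel c z\<bar> \<le> 1"
proof -
  have "z * (bessel' c z)\<^sup>2 \<ge> 0"
    using assms by simp
  then show ?thesis
    using bessel_energy[OF assms] by (intro iffD1[OF abs_square_le_1]) linarith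
qed

lemma bessel'_bound:
  assumes "c \<ge> 1 / 2" "z > 0"
  shows "\<bar>bessel' c z\<bar> \<le> z powr (- 1 / 2)"
proof -
  have "z * (bessel' c z)\<^sup>2 \<le> 1"
    using bessel_energy[of c z] assms zero_le_power2[of "bessel c z"] by linarith
  then have "(bessel' c z)\<^sup>2 \<le> 1 / z"
    using assms by (simp add: field_simps)
  then have "\<bar>bessel' c z\<bar> \<le> sqrt (1 / z)"
    using real_le_rsqrt by fastforce
  also have "\<dots> = z powr (- 1 / 2)"
    using assms by (simp add: powr_minus powr_half_sqrt real_sqrt_divide field_simps)
  finally show ?thesis .
qed

text \<open>An integrating factor: the derivative of \<open>w powr p * f w\<close> is
  \<open>w powr (p - 1)\<close> times the assumed nonnegative expression.\<close>

lemma powr_mult_mono_of_deriv: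
  fixes f f' :: "real \<Rightarrow> real"
  assumes "\<And>w. w > 0 \<Longrightarrow> (f has_real_derivative f' w) (at w)"
    and "0 < x" "x \<le> z"
    and "\<And>w. w > 0 \<Longrightarrow> w * f' w + p * f w \<ge> 0"
  shows "x powr p * f x \<le> z powr p * f z"
proof (rule DERIV_nonneg_imp_nondecreasing[OF assms(3)])
  fix w assume "x \<le> w" "w \<le> z"
  then have w: "w > 0" using assms by simp
  have "((\<lambda>w. w powr p * f w) has_real_derivative w powr (p - 1) * (w * f' w + p * f w)) (at w)"
    using w by (auto intro!: derivative_eq_intros assms(1) simp: powr_diff field_simps)
  moreover have "w powr (p - 1) * (w * f' w + p * f w) \<ge> 0"
    using assms(4)[OF w] by simp
  ultimately show "\<exists>y. ((\<lambda>w. w powr p * f w) has_real_derivative y) (at w) \<and> y \<ge> 0" by blast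
qed

text \<open>With \<open>h = bessel' c + 1 / c\<close> the Bessel equation reads
  \<open>w * h' + c * h = 1 - bessel c w\<close>, which is nonnegative. So
  \<open>w powr c * h w\<close> is nondecreasing, and it starts from 0.\<close>

lemma bessel'_ge:
  assumes "c \<ge> 1 / 2" "z > 0"
  shows "bessel' c z \<ge> - (1 / c)"
proof -
  have c: "c > 0" using assms by simp
  let ?h = "\<lambda>w. bessel' c w + 1 / c"
  have *: "x powr c * ?h x \<le> z powr c * ?h z" if "0 < x" "x \<le> z" for x
  proof (rule powr_mult_mono_of_deriv[OF _ that])
    show "(?h has_real_derivative bessel'' c w) (at w)" for w
      by (auto intro!: derivative_eq_intros bessel_deriv[OF c])
    show "w * bessel'' c w + c * ?h w \<ge> 0" if "w > 0" for w
      using bessel_ode[OF c, of w] bessel_le_1[OF assms(1), of w] that c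
      by (simp add: algebra_simps)
  qed
  \<comment> \<open>The limit is 0 because \<open>0 powr c = 0\<close>; for \<open>h\<close> only
    its continuity at 0 enters.\<close>
  have "((\<lambda>x. x powr c * ?h x) \<longlongrightarrow> 0 powr c * ?h 0) (at_right 0)"
  proof (rule tendsto_mult)
    have "\<forall>\<^sub>F x :: real in at_right 0. 0 \<le> x"
      by (rule eventually_mono[OF eventually_at_right_less]) simp
    then show "((\<lambda>x. x powr c) \<longlongrightarrow> 0 powr c) (at_right 0)"
      using c by (intro tendsto_powr' tendsto_ident_at tendsto_const) auto
    have "(bessel' c \<longlongrightarrow> bessel' c 0) (at_right 0)"
      using DERIV_isCont[OF bessel_deriv(2)[OF c]] by (metis filterlim_at_split isContD)
    then show "((\<lambda>x. ?h x) \<longlongrightarrow> ?h 0) (at_right 0)"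
      by (intro tendsto_intros)
  qed
  then have "0 \<le> z powr c * ?h z"
    using c
    by (intro tendsto_upperbound[of "\<lambda>x. x powr c * ?h x" 0 "at_right 0" "z powr c * ?h z"])
      (auto intro!: * eventually_mono[OF eventually_at_right_real[OF assms(2)]])
  then show ?thesis using assms by (simp add: zero_le_mult_iff)
qed

text \<open>Integrates \<open>bessel'_ge\<close> from 0. This controls the right-hand side of
  \<open>symbol_ode\<close> when \<open>a < 0\<close>.\<close>

lemma bessel_ge:
  assumes "c \<ge> 1 / 2" "z \<ge> 0"
  shows "bessel c z \<ge> 1 - z / c"
proof -
  have c: "c > 0" using assms by simp
  have "bessel c 0 + 0 / c \<le> bessel c z + z / c"
  proof (rule DERIV_nonneg_imp_increasing_open[OF assms(2)])
    fix w :: real assume "0 < w" "w < z"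
    show "\<exists>y. ((\<lambda>z. bessel c z + z / c) has_real_derivative y) (at w) \<and> y \<ge> 0"
      using bessel'_ge[OF assms(1) \<open>0 < w\<close>] c
      by (intro exI[of _ "bessel' c w + 1 / c"])
        (auto intro!: derivative_eq_intros bessel_deriv)
  next
    have "continuous_on {0..z} (bessel c)"
      by (rule DERIV_continuous_on) (auto intro: has_field_derivative_at_within bessel_deriv[OF c])
    then show "continuous_on {0..z} (\<lambda>z. bessel c z + z / c)"
      using c by (auto intro!: continuous_intros)
  qed
  then show ?thesis by (simp add: bessel_0)
qed

section \<open>Lower bounds for the symbol\<close>

text \<open>Supplies the point with a strictly positive value from which the monotonicity argument
  starts.\<close>

lemma eval_fps_pos_near_0:
  fixes f :: "real fps"
  assumes "fps_conv_radius f = \<infinity>" "fps_nth f 0 > 0"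
  shows "\<exists>z>0. eval_fps f z > 0"
proof -
  have "isCont (eval_fps f) 0"
    using assms(1) by (intro continuous_eval_fps) simp
  then have "\<forall>\<^sub>F z in at 0. eval_fps f z > 0"
    using assms(2) by (intro order_tendstoD(1)[of _ "eval_fps f 0"]) (auto simp: isCont_def eval_fps_at_0)
  then have "\<forall>\<^sub>F z in at_right 0. eval_fps f z > 0"
    using eventually_at_split by blast
  then have "\<forall>\<^sub>F z in at_right 0. eval_fps f z > 0 \<and> z > 0"
    using eventually_at_right_less by (rule eventually_conj)
  then show ?thesis
    using eventually_happens[of _ "at_right (0 :: real)"] by auto
qed

lemma symbol_growth:
  assumes "c \<ge> 1 / 2" "a > - 1"
  shows "\<exists>C>0. \<exists>x>0. \<forall>z\<ge>x. symbol a c z \<ge> C * z powr (1 - a)"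
proof -
  have c: "c > 0" using assms by simp
  note R = conv_radius_symbol_fps[OF c assms(2)]
  \<comment> \<open>For \<open>a < 0\<close> the right-hand side of \<open>symbol_ode\<close> has
    the wrong sign. Subtracting \<open>w\<close>, which solves the same equation with right-hand
    side \<open>a * w\<close>, repairs it.\<close>
  define \<kappa> :: real where "\<kappa> = (if a \<ge> 0 then 0 else 1)"
  let ?h = "\<lambda>w. symbol a c w - \<kappa> * w"
  have "\<exists>x>0. ?h x > 0"
  proof (cases "a \<ge> 0")
    case True
    have "\<exists>x>0. eval_fps (symbol_fps a c) x > 0"
      by (rule eval_fps_pos_near_0[OF R]) (simp add: symbol_fps_def)
    then show ?thesis
      using True R by (auto simp: \<kappa>_def symbol_def eval_fps_mult)
  next
    case False
    \<comment> \<open>After the linear term is removed, the leading coefficient is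
      \<open>- a / (2 * (a + 1) * (c + 1))\<close>, positive for \<open>- 1 < a < 0\<close>.\<close>
    have R': "fps_conv_radius (fps_shift 1 (symbol_fps a c)) = \<infinity>"
      using R by simp
    have "\<exists>x>0. eval_fps (fps_shift 1 (symbol_fps a c)) x > 0"
      using False c assms(2)
      by (intro eval_fps_pos_near_0[OF R'])
        (auto simp: symbol_fps_def intro!: divide_neg_pos mult_pos_pos)
    then obtain x where x: "x > 0" "eval_fps (fps_shift 1 (symbol_fps a c)) x > 0" by blast
    have "symbol_fps a c = fps_X * fps_shift 1 (symbol_fps a c) + 1"
      by (rule fps_ext) (auto simp: symbol_fps_def)
    then have "symbol a c x = eval_fps (fps_X * (fps_X * fps_shift 1 (symbol_fps a c) + 1)) x"
      unfolding symbol_def by metis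
    also have "\<dots> = x * (x * eval_fps (fps_shift 1 (symbol_fps a c)) x + 1)"
      using R' by (simp add: eval_fps_mult eval_fps_add conv_radius_mult_inf conv_radius_add_inf)
    finally have "?h x = x * x * eval_fps (fps_shift 1 (symbol_fps a c)) x"
      using False by (simp add: \<kappa>_def algebra_simps)
    then show ?thesis using x by (metis mult_pos_pos)
  qed
  then obtain x where x: "x > 0" "?h x > 0" by blast
  have mono: "x powr (a - 1) * ?h x \<le> z powr (a - 1) * ?h z" if "x \<le> z" for z
  proof (rule powr_mult_mono_of_deriv[OF _ x(1) that])
    show "(?h has_real_derivative symbol' a c w - \<kappa>) (at w)" for w
      by (auto intro!: derivative_eq_intros symbol_deriv[OF c assms(2)])
    fix w :: real assume w: "w > 0"
    have "w * (symbol' a c w - \<kappa>) + (a - 1) * ?h w = a * (c * (1 - bessel c w) - \<kappa> * w)"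
      using symbol_ode[OF c assms(2), of w] by (simp add: algebra_simps)
    also have "\<dots> \<ge> 0"
    proof (cases "a \<ge> 0")
      case True
      then show ?thesis
        using bessel_le_1[OF assms(1), of w] w c by (auto simp: \<kappa>_def)
    next
      case False
      have "c * (1 - bessel c w) \<le> w"
        using bessel_ge[OF assms(1), of w] w c by (simp add: field_simps)
      then show ?thesis using False by (auto simp: \<kappa>_def intro: mult_nonpos_nonpos)
    qed
    finally show "w * (symbol' a c w - \<kappa>) + (a - 1) * ?h w \<ge> 0" .
  qed
  have "symbol a c z \<ge> (x powr (a - 1) * ?h x) * z powr (1 - a)" if "x \<le> z" for z
  proof -
    have z: "z > 0" using x that by simp
    have "(x powr (a - 1) * ?h x) * z powr (1 - a) \<le> (z powr (a - 1) * ?h z) * z powr (1 - a)"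
      using mono[OF that] by (rule mult_right_mono) simp
    also have "\<dots> = ?h z * (z powr (a - 1) * z powr (1 - a))" by simp
    also have "\<dots> = ?h z" using z by (simp flip: powr_add)
    also have "\<dots> \<le> symbol a c z" using z by (simp add: \<kappa>_def)
    finally show ?thesis .
  qed
  then show ?thesis
    using x by (intro exI[of _ "x powr (a - 1) * ?h x"]) (auto intro!: exI[of _ x])
qed

text \<open>On the compact interval up to \<open>x\<close> the continuous difference is bounded, so
  a larger constant extends an asymptotic bound to all \<open>z \<ge> 0\<close>.\<close>

lemma symbol_lower_bound_extend:
  fixes f :: "real \<Rightarrow> real"
  assumes "c > 0" "a > - 1" "continuous_on {0..} f"
    and "\<And>z. z \<ge> x \<Longrightarrow> symbol a c z \<ge> f z - B"
  shows "\<exists>A. \<forall>z\<ge>0. symbol a c z \<ge> f z - A"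
proof -
  have "continuous_on {0..x} f"
    using assms(3) by (rule continuous_on_subset) auto
  moreover have "continuous_on {0..x} (symbol a c)"
    by (rule DERIV_continuous_on[of _ _ "symbol' a c"])
      (auto intro: has_field_derivative_at_within symbol_deriv[OF assms(1,2)])
  ultimately have "continuous_on {0..x} (\<lambda>z. symbol a c z - f z)"
    by (intro continuous_intros)
  then have "bounded ((\<lambda>z. symbol a c z - f z) ` {0..x})"
    by (intro compact_imp_bounded compact_continuous_image) auto
  then obtain K where K: "\<And>z. z \<in> {0..x} \<Longrightarrow> \<bar>symbol a c z - f z\<bar> \<le> K"
    unfolding bounded_iff by (metis imageI real_norm_def)
  have "symbol a c z \<ge> f z - max K B" if "z \<ge> 0" for z
    using assms(4)[of z] K[of z] that by (cases "z \<le> x") auto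
  then show ?thesis by blast
qed

lemma symbol_bounded_below:
  assumes "c \<ge> 1 / 2" "a > - 1"
  shows "\<exists>A. \<forall>z\<ge>0. symbol a c z \<ge> - A"
proof -
  obtain C x where C: "C > 0" "\<And>z. z \<ge> x \<Longrightarrow> symbol a c z \<ge> C * z powr (1 - a)"
    using symbol_growth[OF assms] by blast
  have "symbol a c z \<ge> 0 - 0" if "z \<ge> x" for z
    using C(2)[OF that] C(1) by (smt (verit) mult_nonneg_nonneg powr_ge_zero)
  then show ?thesis
    using symbol_lower_bound_extend[of c a "\<lambda>_. 0" x 0] assms by auto
qed

lemma symbol_ge_powr:
  assumes "c \<ge> 1 / 2" "a > - 1" "a < 1"
  shows "\<exists>C>0. \<exists>A. \<forall>z\<ge>0. symbol a c z \<ge> C * (1 + z) powr (1 - a) - A"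
proof -
  obtain C x where C: "C > 0" "x > 0" "\<And>z. z \<ge> x \<Longrightarrow> symbol a c z \<ge> C * z powr (1 - a)"
    using symbol_growth[OF assms(1,2)] by blast
  \<comment> \<open>For \<open>z \<ge> x\<close> one has \<open>1 + z \<le> (1 + 1 / x) * z\<close>;
    this constant pays for replacing \<open>z\<close> by \<open>1 + z\<close>, the form later
    compared with the lattice weight.\<close>
  let ?D = "C / (1 + 1 / x) powr (1 - a)"
  have x: "1 + 1 / x > 0" using C by (simp add: add_pos_pos)
  have "symbol a c z \<ge> ?D * (1 + z) powr (1 - a) - 0" if "z \<ge> x" for z
  proof -
    have "1 + z \<le> (1 + 1 / x) * z" using that C by (simp add: field_simps)
    then have "(1 + z) powr (1 - a) \<le> ((1 + 1 / x) * z) powr (1 - a)"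
      using that C assms by (intro powr_mono2) auto
    also have "\<dots> = (1 + 1 / x) powr (1 - a) * z powr (1 - a)"
      by (rule powr_mult)
    finally have "?D * (1 + z) powr (1 - a) \<le> ?D * ((1 + 1 / x) powr (1 - a) * z powr (1 - a))"
      using C by (intro mult_left_mono) auto
    also have "\<dots> = C * z powr (1 - a)" using x by simp
    finally show ?thesis using C(3)[OF that] by simp
  qed
  then have "\<exists>A. \<forall>z\<ge>0. symbol a c z \<ge> ?D * (1 + z) powr (1 - a) - A"
    using assms by (intro symbol_lower_bound_extend[of c a _ x 0]) (use x in \<open>auto intro!: continuous_intros\<close>)
  moreover have "?D > 0" using C x by simp
  ultimately show ?thesis by blast
qed

text \<open>
  Substituting the Bessel equation for \<open>bessel\<close> turns the derivative of \<open>symbol 1 c z - c ln z\<close> into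
  an exact derivative plus an integrable remainder of order \<open>z powr (- 3 / 2)\<close>.
\<close>

lemma symbol_1_ge_ln:
  assumes "c \<ge> 1 / 2"
  shows "\<exists>A. \<forall>z\<ge>0. symbol 1 c z \<ge> c * ln (1 + z) - A"
proof -
  have c: "c > 0" using assms by simp
  \<comment> \<open>The last term contributes \<open>c\<^sup>2 * z powr (- 3 / 2)\<close> to the
    derivative, which offsets the remainder \<open>c\<^sup>2 * bessel' c z / z\<close> by
    \<open>bessel'_bound\<close>.\<close>
  define Q where "Q z = symbol 1 c z - c * ln z - c * bessel' c z - 2 * c\<^sup>2 * z powr (- 1 / 2)" for z
  have Q: "Q 1 \<le> Q z" if "1 \<le> z" for z
  proof (rule DERIV_nonneg_imp_nondecreasing[OF that])
    fix w :: real assume "1 \<le> w"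
    then have w: "w > 0" by simp
    have "w * (symbol' 1 c w - c / w - c * bessel'' c w)
        = (w * symbol' 1 c w - c) - c * (w * bessel'' c w)"
      using w by (simp add: algebra_simps)
    also have "w * symbol' 1 c w - c = - c * bessel c w"
      using symbol_ode[OF c, of 1 w] by (simp add: algebra_simps)
    also have "w * bessel'' c w = - (c * bessel' c w + bessel c w)"
      using bessel_ode[OF c, of w] by simp
    finally have "w * (symbol' 1 c w - c / w - c * bessel'' c w) = c\<^sup>2 * bessel' c w"
      by (simp add: algebra_simps power2_eq_square)
    then have "symbol' 1 c w - c / w - c * bessel'' c w = c\<^sup>2 * bessel' c w / w"
      using w by (simp add: eq_divide_eq mult.commute)
    moreover have "(Q has_real_derivative
        symbol' 1 c w - c / w - c * bessel'' c w - 2 * c\<^sup>2 * (- 1 / 2 * w powr (- 1 / 2 - 1))) (at w)"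
      unfolding Q_def using w
      by (auto intro!: derivative_eq_intros symbol_deriv[OF c] bessel_deriv[OF c])
    moreover have "w powr (- 1 / 2 - 1) = w powr (- 1 / 2) / w"
      using w by (simp only: powr_diff powr_one)
    ultimately have "(Q has_real_derivative c\<^sup>2 * (bessel' c w + w powr (- 1 / 2)) / w) (at w)"
      by (simp add: algebra_simps add_divide_distrib)
    moreover have "c\<^sup>2 * (bessel' c w + w powr (- 1 / 2)) / w \<ge> 0"
      using bessel'_bound[OF assms w] w by (intro divide_nonneg_nonneg mult_nonneg_nonneg) auto
    ultimately show "\<exists>y. (Q has_real_derivative y) (at w) \<and> y \<ge> 0" by blast
  qed
  have "symbol 1 c z \<ge> c * ln (1 + z) - (c * ln 2 + c - Q 1)" if "z \<ge> 1" for z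
  proof -
    have "\<bar>bessel' c z\<bar> \<le> 1"
    proof -
      have "z powr (- 1 / 2) \<le> 1 powr (- 1 / 2)"
        using that by (intro powr_mono2') auto
      then show ?thesis using bessel'_bound[OF assms, of z] that by simp
    qed
    then have "c * bessel' c z \<ge> c * (- 1)"
      using c by (intro mult_left_mono) auto
    moreover have "ln (1 + z) \<le> ln (2 * z)" using that by simp
    then have "c * ln (1 + z) \<le> c * (ln 2 + ln z)"
      using c that by (simp add: ln_mult)
    moreover have "2 * c\<^sup>2 * z powr (- 1 / 2) \<ge> 0" by simp
    ultimately show ?thesis
      using Q[OF that] unfolding Q_def[of z] distrib_left by linarith
  qed
  then show ?thesis
    using c by (intro symbol_lower_bound_extend[of c 1 _ 1]) (auto intro!: continuous_intros)
qed

section \<open>Fourier series of periodic distributions\<close>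

lemma iter_partial_partial_deriv:
  "iter_partial js (partial_deriv i \<phi>) = iter_partial (js @ [i]) \<phi>"
  by (simp add: iter_partial_def)

lemma test_functions_continuous:
  assumes "\<phi> \<in> test_functions r"
  shows "continuous_on S (iter_partial js \<phi>)"
  using assms by (auto simp: test_functions_def intro: continuous_on_subset[OF differentiable_imp_continuous_on])

lemma test_functions_continuous_fun:
  assumes "\<phi> \<in> test_functions r"
  shows "continuous_on S \<phi>"
  using test_functions_continuous[OF assms, of S "[]"] by (simp add: iter_partial_def)

lemma test_functions_differentiable:
  assumes "\<phi> \<in> test_functions r"
  shows "\<phi> differentiable (at x)"
proof -
  have "iter_partial [] \<phi> differentiable_on UNIV"
    using assms unfolding test_functions_def by blast
  then show ?thesis by (simp add: iter_partial_def differentiable_on_def)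
qed

lemma test_functions_periodic:
  assumes "\<phi> \<in> test_functions r"
  shows "\<phi> (x + (r $ i) *\<^sub>R axis i 1) = \<phi> x"
  using assms by (simp add: test_functions_def)

lemma partial_deriv_test_functions:
  assumes "\<phi> \<in> test_functions r"
  shows "partial_deriv i \<phi> \<in> test_functions r"
proof -
  \<comment> \<open>Periodicity passes to the derivative: a function invariant under translation by
    \<open>v\<close> has the derivative at \<open>x + v\<close> also as derivative at
    \<open>x\<close>, and derivatives are unique.\<close>
  have "partial_deriv i \<phi> (x + v) = partial_deriv i \<phi> x" if v: "\<And>x. \<phi> (x + v) = \<phi> x" for x v
  proof -
    have "(\<phi> has_derivative frechet_derivative \<phi> (at (x + v))) (at (x + v))"
      using test_functions_differentiable[OF assms] by (simp add: frechet_derivative_works)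
    then have "((\<lambda>y. \<phi> (y + v)) has_derivative frechet_derivative \<phi> (at (x + v))) (at x)"
      by (rule has_derivative_compose[where f = "\<lambda>y. y + v", rotated])
        (auto intro!: derivative_eq_intros)
    then have "(\<phi> has_derivative frechet_derivative \<phi> (at (x + v))) (at x)"
      by (simp add: v)
    then show ?thesis
      using frechet_derivative_at by (metis partial_deriv_def)
  qed
  then show ?thesis
    using assms by (auto simp: test_functions_def iter_partial_partial_deriv)
qed

lemma iter_partial_replicate_test_functions:
  assumes "\<phi> \<in> test_functions r"
  shows "iter_partial (replicate m i) \<phi> \<in> test_functions r"
  using assms by (induction m) (auto simp: iter_partial_def intro: partial_deriv_test_functions)

lemma partial_deriv_vector_derivative:
  assumes "\<phi> differentiable (at (x + h *\<^sub>R axis i 1))"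
  shows "((\<lambda>h. \<phi> (x + h *\<^sub>R axis i 1)) has_vector_derivative
    partial_deriv i \<phi> (x + h *\<^sub>R axis i 1)) (at h within U)"
proof -
  have D: "(\<phi> has_derivative frechet_derivative \<phi> (at (x + h *\<^sub>R axis i 1))) (at (x + h *\<^sub>R axis i 1))"
    using assms by (simp add: frechet_derivative_works)
  have "((\<lambda>h. \<phi> (x + h *\<^sub>R axis i 1)) has_derivative
      (\<lambda>y. frechet_derivative \<phi> (at (x + h *\<^sub>R axis i 1)) (y *\<^sub>R axis i 1))) (at h within U)"
    by (rule has_derivative_compose[where f = "\<lambda>h. x + h *\<^sub>R axis i 1", OF _ D])
      (auto intro!: derivative_eq_intros)
  then show ?thesis
    unfolding has_vector_derivative_def partial_deriv_def
    by (simp add: linear_cmul[OF has_derivative_linear[OF D]])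
qed

section \<open>Translation invariance of integrals and orthogonality of modes\<close>

lemma integral_cbox_split:
  fixes f :: "'a :: euclidean_space \<Rightarrow> 'b :: banach"
  assumes "f integrable_on cbox a b" "k \<in> Basis"
  shows "integral (cbox a b) f =
    integral (cbox a b \<inter> {x. x \<bullet> k \<le> c}) f + integral (cbox a b \<inter> {x. x \<bullet> k \<ge> c}) f"
  using integrable_split[OF assms]
  by (intro integral_unique has_integral_split[OF _ _ assms(2)]) (auto simp: has_integral_integral)

text \<open>Cut the translated box at the face where coordinate \<open>i\<close> equals
  \<open>r $ i\<close>. The part beyond it, moved back by one period, fills the slab that the
  translation vacated.\<close>

lemma integral_periodic_shift:
  fixes g :: "real ^ 'n \<Rightarrow> complex"
  assumes cont: "continuous_on UNIV g"
    and per: "\<And>x. g (x + (r $ i) *\<^sub>R axis i 1) = g x"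
    and h: "0 \<le> h" "h \<le> r $ i"
  shows "integral (cbox 0 r) (\<lambda>x. g (x + h *\<^sub>R axis i 1)) = integral (cbox 0 r) g"
proof -
  define e where "e = (axis i 1 :: real ^ 'n)"
  \<comment> \<open>The upper corner of the vacated slab, where coordinate \<open>i\<close> runs
    from 0 to \<open>h\<close>.\<close>
  define u where "u = (\<chi> j. if j = i then h else r $ j)"
  have e: "e \<in> Basis" "\<And>x. x \<bullet> e = x $ i" "e $ i = 1" "\<And>j. j \<noteq> i \<Longrightarrow> e $ j = 0"
    by (auto simp: e_def inner_axis axis_in_Basis_iff) (simp add: axis_def)
  let ?A = "cbox (0 + h *\<^sub>R e) (r + h *\<^sub>R e)"
  have int: "g integrable_on cbox a b" for a b
    by (rule integrable_continuous) (rule continuous_on_subset[OF cont], simp)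
  have "integral (cbox 0 r) (\<lambda>x. g (x + h *\<^sub>R e)) = integral ?A g"
    using integral_shift_cbox_plus[of 0 r g "h *\<^sub>R e"] by (simp add: o_def add.commute)
  also have "\<dots> = integral (?A \<inter> {x. x \<bullet> e \<le> r $ i}) g + integral (?A \<inter> {x. x \<bullet> e \<ge> r $ i}) g"
    by (rule integral_cbox_split[OF int e(1)])
  also have "?A \<inter> {x. x \<bullet> e \<le> r $ i} = cbox 0 r \<inter> {x. x \<bullet> e \<ge> h}"
    using h by (auto simp: mem_box_cart e; smt (verit) e mult_cancel_left1 mult_eq_0_iff)
  also have "?A \<inter> {x. x \<bullet> e \<ge> r $ i} = cbox (0 + (r $ i) *\<^sub>R e) (u + (r $ i) *\<^sub>R e)"
    using h by (auto simp: mem_box_cart e u_def; smt (verit) e mult_cancel_left1 mult_eq_0_iff)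
  also have "integral \<dots> g = integral (cbox 0 u) g"
    using integral_shift_cbox_plus[of 0 u g "(r $ i) *\<^sub>R e"] per
    by (simp add: o_def add.commute e_def)
  also have "cbox 0 u = cbox 0 r \<inter> {x. x \<bullet> e \<le> h}"
    using h by (auto simp: mem_box_cart e u_def split: if_splits) (smt (verit))+
  also have "integral (cbox 0 r \<inter> {x. x \<bullet> e \<ge> h}) g + integral (cbox 0 r \<inter> {x. x \<bullet> e \<le> h}) g
      = integral (cbox 0 r) g"
    using integral_cbox_split[OF int e(1)] by (simp add: add.commute)
  finally show ?thesis by (simp add: e_def)
qed

lemma mode_add: "mode r k (x + y) = mode r k x * exp (\<i> * complex_of_real (freq r k \<bullet> y))"
  by (simp add: mode_def inner_add_right distrib_left exp_add)

lemma freq_inner_axis: "freq r k \<bullet> (h *\<^sub>R axis i 1) = h * freq r k $ i"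
  by (simp add: inner_axis)

lemma mode_shift:
  "mode r k (x + h *\<^sub>R axis i 1) = mode r k x * exp (\<i> * complex_of_real (h * freq r k $ i))"
  by (simp only: mode_add freq_inner_axis)

lemma mode_periodic:
  assumes "r $ i > 0"
  shows "mode r k (x + (r $ i) *\<^sub>R axis i 1) = mode r k x"
proof -
  have "(r $ i) * freq r k $ i = 2 * pi * of_int (k $ i)"
    using assms by (simp add: freq_def)
  moreover have "exp (\<i> * complex_of_real (2 * pi * of_int (k $ i))) = 1"
    using exp_integer_2pi[of "of_int (k $ i)"] by (simp add: mult_ac)
  ultimately show ?thesis by (simp only: mode_shift mult_1_right)
qed

lemma norm_mode [simp]: "cmod (mode r k x) = 1"
  by (simp add: mode_def)

lemma continuous_on_mode [continuous_intros]: "continuous_on S (mode r k)"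
  unfolding mode_def by (intro continuous_intros)

text \<open>In place of integration by parts, the pairing with the translate of
  \<open>\<phi>\<close> by \<open>h\<close> is differentiated at \<open>h = 0\<close> in two ways:
  under the integral, and after moving the translation onto the mode, where it becomes an
  exponential factor.\<close>

lemma mode_pairing_partial_deriv:
  fixes r :: "real ^ 'n"
  assumes r: "\<forall>i. r $ i > 0" and \<phi>: "\<phi> \<in> test_functions r"
  shows "mode_pairing r k (partial_deriv i \<phi>) =
    - (\<i> * complex_of_real (freq r k $ i)) * mode_pairing r k \<phi>"
proof -
  let ?e = "axis i 1 :: real ^ 'n" and ?w = "\<i> * complex_of_real (freq r k $ i)"
  let ?F = "\<lambda>h. integral (cbox 0 r) (\<lambda>x. mode r k x * \<phi> (x + h *\<^sub>R ?e))"
  note cont = test_functions_continuous_fun[OF \<phi>]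
    test_functions_continuous_fun[OF partial_deriv_test_functions[OF \<phi>]]
  have F: "?F h = exp (- (of_real h * ?w)) * mode_pairing r k \<phi>" if "h \<in> {0..r $ i}" for h
  proof -
    have "?F h = integral (cbox 0 r) (\<lambda>x. exp (- (of_real h * ?w)) *
        (mode r k (x + h *\<^sub>R ?e) * \<phi> (x + h *\<^sub>R ?e)))"
      unfolding mode_shift by (simp add: exp_minus mult_ac divide_simps)
    also have "\<dots> = exp (- (of_real h * ?w)) *
        integral (cbox 0 r) (\<lambda>x. mode r k (x + h *\<^sub>R ?e) * \<phi> (x + h *\<^sub>R ?e))"
      by simp
    also have "integral (cbox 0 r) (\<lambda>x. mode r k (x + h *\<^sub>R ?e) * \<phi> (x + h *\<^sub>R ?e))
        = integral (cbox 0 r) (\<lambda>x. mode r k x * \<phi> x)"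
      using that r
      by (intro integral_periodic_shift[of "\<lambda>x. mode r k x * \<phi> x"])
        (auto intro!: continuous_intros cont simp: mode_periodic test_functions_periodic[OF \<phi>])
    finally show ?thesis by (simp add: mode_pairing_def)
  qed
  have "(?F has_vector_derivative
      integral (cbox 0 r) (\<lambda>x. mode r k x * partial_deriv i \<phi> (x + 0 *\<^sub>R ?e))) (at 0 within {0..r $ i})"
  proof (rule leibniz_rule_vector_derivative)
    show "((\<lambda>h. mode r k x * \<phi> (x + h *\<^sub>R ?e)) has_vector_derivative
        mode r k x * partial_deriv i \<phi> (x + h *\<^sub>R ?e)) (at h within {0..r $ i})" for h x
      by (intro has_vector_derivative_mult_right partial_deriv_vector_derivative
          test_functions_differentiable[OF \<phi>])
    show "(\<lambda>x. mode r k x * \<phi> (x + h *\<^sub>R ?e)) integrable_on cbox 0 r" for h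
      by (intro integrable_continuous continuous_intros continuous_on_compose2[OF cont(1)]) auto
    show "continuous_on ({0..r $ i} \<times> cbox 0 r)
        (\<lambda>(h, x). mode r k x * partial_deriv i \<phi> (x + h *\<^sub>R ?e))"
      unfolding split_beta
      by (intro continuous_intros continuous_on_compose2[OF cont(2)]
          continuous_on_compose2[OF continuous_on_mode]) auto
  qed (use r in \<open>auto simp: less_imp_le\<close>)
  then have 1: "(?F has_vector_derivative mode_pairing r k (partial_deriv i \<phi>)) (at 0 within {0..r $ i})"
    by (simp add: mode_pairing_def)
  have "((\<lambda>h. exp (- (of_real h * ?w)) * mode_pairing r k \<phi>) has_vector_derivative
      - ?w * mode_pairing r k \<phi>) (at 0 within {0..r $ i})"
    by (auto intro!: derivative_eq_intros has_vector_derivative_real_field)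
  then have 2: "(?F has_vector_derivative - ?w * mode_pairing r k \<phi>) (at 0 within {0..r $ i})"
    by (rule has_vector_derivative_transform[rotated 2]) (use r F in \<open>auto simp: less_imp_le\<close>)
  \<comment> \<open>Both are one-sided derivatives at the left end of a nondegenerate interval,
    hence equal.\<close>
  show ?thesis
    using r vector_derivative_unique_within_closed_interval[of 0 "r $ i" 0, OF _ _ 1[folded cbox_interval] 2[folded cbox_interval]]
    by (auto simp: less_imp_le)
qed

text \<open>For \<open>k \<noteq> 0\<close>, translation by half a wavelength in a direction with
  \<open>k $ i \<noteq> 0\<close> changes the sign of the mode, so its integral equals its own
  negative.\<close>

lemma integral_mode:
  fixes r :: "real ^ 'n"
  assumes r: "\<forall>i. r $ i > 0"
  shows "integral (cbox 0 r) (mode r k) = (if k = 0 then complex_of_real (\<Prod>i\<in>UNIV. r $ i) else 0)"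
proof (cases "k = 0")
  case True
  then have "mode r k = (\<lambda>x. 1)" by (auto simp: mode_def freq_def fun_eq_iff inner_vec_def)
  moreover have "measure lborel (cbox 0 r) = (\<Prod>i\<in>UNIV. r $ i)"
    using r by (subst content_cbox_cart) (auto simp: interval_ne_empty_cart less_imp_le)
  ultimately show ?thesis using True by (simp add: scaleR_conv_of_real)
next
  case False
  then obtain i where i: "k $ i \<noteq> 0" by (auto simp: vec_eq_iff)
  define h where "h = r $ i / (2 * \<bar>of_int (k $ i)\<bar>)"
  have "\<bar>real_of_int (k $ i)\<bar> \<ge> 1" using i by linarith
  moreover have "r $ i > 0" using r by blast
  ultimately have h: "0 \<le> h" "h \<le> r $ i"
    by (auto simp: h_def divide_le_eq mult_le_cancel_left1)
  have "h * freq r k $ i = pi * sgn (of_int (k $ i))"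
    using i r by (simp add: h_def freq_def sgn_if abs_if less_imp_neq[symmetric])
  then have "exp (\<i> * complex_of_real (h * freq r k $ i)) = - 1"
    using i by (simp add: sgn_if exp_minus exp_pi_i' split: if_splits)
  then have "mode r k (x + h *\<^sub>R axis i 1) = - mode r k x" for x
    by (simp add: mode_shift)
  then have "integral (cbox 0 r) (mode r k) = integral (cbox 0 r) (\<lambda>x. - mode r k x)"
    using integral_periodic_shift[of "mode r k" r i h] h r
    by (simp add: continuous_on_mode mode_periodic)
  then show ?thesis using False by simp
qed

lemma mode_pairing_mode:
  fixes r :: "real ^ 'n"
  assumes "\<forall>i. r $ i > 0"
  shows "mode_pairing r j (mode r (- k)) = (if j = k then complex_of_real (\<Prod>i\<in>UNIV. r $ i) else 0)"
proof -
  have "freq r (j - k) = freq r j + freq r (- k)"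
    by (simp add: freq_def vec_eq_iff diff_divide_distrib algebra_simps)
  then have "mode r j x * mode r (- k) x = mode r (j - k) x" for x
    by (simp add: mode_def inner_add_left exp_add distrib_left)
  then show ?thesis by (simp add: mode_pairing_def integral_mode[OF assms])
qed

section \<open>Lattice weights and their summability\<close>

definition lattice_weight :: "int ^ 'n \<Rightarrow> real" where
  "lattice_weight k = 1 + (norm (\<chi> i. real_of_int (k $ i)))\<^sup>2"

lemma lattice_weight_eq: "lattice_weight k = 1 + (\<Sum>i\<in>UNIV. (real_of_int (k $ i))\<^sup>2)"
  unfolding lattice_weight_def power2_norm_eq_inner by (simp add: inner_vec_def power2_eq_square)

lemma lattice_weight_ge_1: "lattice_weight k \<ge> 1"
  by (simp add: lattice_weight_def)

lemma lattice_weight_pos: "lattice_weight k > 0"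
  using lattice_weight_ge_1[of k] by linarith

lemma lattice_weight_powr_0 [simp]: "lattice_weight k powr 0 = 1"
  using lattice_weight_pos[of k] by simp

text \<open>The bound telescopes: the two new terms amount to at most
  \<open>4 / (m + 1) - 4 / (m + 2)\<close>, because
  \<open>(m + 1) * (m + 2) \<le> 2 * (1 + (m + 1)\<^sup>2)\<close>. For \<open>m = 0\<close> it is
  an equality.\<close>

lemma sum_inverse_squares_le:
  "(\<Sum>z\<in>{- int m..int m}. 1 / (1 + (real_of_int z)\<^sup>2)) \<le> 5 - 4 / (real m + 1)"
proof (induction m)
  case (Suc m)
  have "{- int (Suc m)..int (Suc m)} = insert (- int (Suc m)) (insert (int (Suc m)) {- int m..int m})"
    by auto
  then have "(\<Sum>z\<in>{- int (Suc m)..int (Suc m)}. 1 / (1 + (real_of_int z)\<^sup>2))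
      = 2 / (1 + (real m + 1)\<^sup>2) + (\<Sum>z\<in>{- int m..int m}. 1 / (1 + (real_of_int z)\<^sup>2))"
    by (simp add: add_ac power2_eq_square algebra_simps)
  also have "\<dots> \<le> 2 / (1 + (real m + 1)\<^sup>2) + (5 - 4 / (real m + 1))"
    using Suc by simp
  also have "2 / (1 + (real m + 1)\<^sup>2) \<le> 2 / ((real m + 1) * (real m + 2) / 2)"
    by (rule frac_le) (auto simp: power2_eq_square algebra_simps add_pos_nonneg)
  also have "2 / ((real m + 1) * (real m + 2) / 2) = 4 / ((real m + 1) * (real m + 2))"
    by simp
  also have "4 / ((real m + 1) * (real m + 2)) = 4 / (real m + 1) - 4 / (real m + 2)"
    by (simp add: field_simps)
  finally show ?case by (simp add: add_ac)
qed simp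

text \<open>The weight dominates \<open>1 + (k $ i)\<^sup>2\<close> for every \<open>i\<close>, so
  its power with exponent the dimension dominates their product. Over a box the sum of products
  factors into one-dimensional sums, each at most 5.\<close>

lemma summable_lattice_weight:
  "(\<lambda>k :: int ^ 'n. 1 / lattice_weight k ^ CARD('n)) summable_on UNIV"
proof (rule nonneg_bdd_above_summable_on)
  let ?f = "\<lambda>z. 1 / (1 + (real_of_int z)\<^sup>2)"
  show "1 / lattice_weight k ^ CARD('n) \<ge> 0" for k :: "int ^ 'n"
    using lattice_weight_pos[of k] by simp
  show "bdd_above (sum (\<lambda>k :: int ^ 'n. 1 / lattice_weight k ^ CARD('n)) ` {F. F \<subseteq> UNIV \<and> finite F})"
  proof (rule bdd_aboveI2)
    fix F :: "(int ^ 'n) set" assume "F \<in> {F. F \<subseteq> UNIV \<and> finite F}"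
    then have F: "finite F" by simp
    have "finite ((\<lambda>(k, i). nat \<bar>k $ i\<bar>) ` (F \<times> UNIV))" using F by simp
    then obtain m where "\<forall>n\<in>(\<lambda>(k, i). nat \<bar>k $ i\<bar>) ` (F \<times> UNIV). n \<le> m"
      unfolding finite_nat_set_iff_bounded_le by blast
    then have m: "nat \<bar>k $ i\<bar> \<le> m" if "k \<in> F" for k i
      using that by auto
    define B where "B = {- int m..int m}"
    have "vec_nth k \<in> (UNIV \<rightarrow>\<^sub>E B)" if "k \<in> F" for k
    proof -
      have "k $ i \<in> B" for i using m[OF that, of i] unfolding B_def by auto
      then show ?thesis by (simp add: PiE_UNIV_domain)
    qed
    then have sub: "vec_nth ` F \<subseteq> (UNIV \<rightarrow>\<^sub>E B)" by blast
    have "(\<Sum>k\<in>F. 1 / lattice_weight k ^ CARD('n)) \<le> (\<Sum>k\<in>F. \<Prod>i\<in>UNIV. ?f (k $ i))"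
    proof (rule sum_mono)
      fix k :: "int ^ 'n"
      have "(real_of_int (k $ i))\<^sup>2 \<le> (\<Sum>i\<in>UNIV. (real_of_int (k $ i))\<^sup>2)" for i
        by (rule member_le_sum) auto
      then have "1 / lattice_weight k \<le> ?f (k $ i)" for i
        unfolding lattice_weight_eq by (intro frac_le) (auto simp: add_pos_nonneg)
      then have "(\<Prod>i\<in>(UNIV :: 'n set). 1 / lattice_weight k) \<le> (\<Prod>i\<in>UNIV. ?f (k $ i))"
        using lattice_weight_pos[of k] by (intro prod_mono) auto
      then show "1 / lattice_weight k ^ CARD('n) \<le> (\<Prod>i\<in>UNIV. ?f (k $ i))"
        by (simp add: power_one_over)
    qed
    also have "\<dots> = (\<Sum>g\<in>vec_nth ` F. \<Prod>i\<in>UNIV. ?f (g i))"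
      by (subst sum.reindex) (auto simp: inj_on_def vec_nth_inject)
    also have "\<dots> \<le> (\<Sum>g\<in>(UNIV :: 'n set) \<rightarrow>\<^sub>E B. \<Prod>i\<in>UNIV. ?f (g i))"
      using sub by (intro sum_mono2) (auto intro!: finite_PiE prod_nonneg simp: B_def)
    also have "\<dots> = (\<Prod>i\<in>(UNIV :: 'n set). \<Sum>z\<in>B. ?f z)"
      by (subst prod_sum_PiE) (auto simp: B_def)
    also have "\<dots> \<le> (\<Prod>i\<in>(UNIV :: 'n set). 5)"
    proof (rule prod_mono)
      have "(\<Sum>z\<in>B. ?f z) \<le> 5"
        unfolding B_def by (rule order_trans[OF sum_inverse_squares_le]) simp
      moreover have "0 \<le> (\<Sum>z\<in>B. ?f z)" by (intro sum_nonneg) auto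
      ultimately show "0 \<le> (\<Sum>z\<in>B. ?f z) \<and> (\<Sum>z\<in>B. ?f z) \<le> 5" by blast
    qed
    finally show "(\<Sum>k\<in>F. 1 / lattice_weight k ^ CARD('n)) \<le> (\<Prod>i\<in>(UNIV :: 'n set). 5)" .
  qed
qed

section \<open>Rapid decay of the mode pairings\<close>

text \<open>The right-hand side of the continuity condition in \<open>periodic_distribution\<close>,
  without its constant.\<close>

definition test_norm :: "real ^ 'n \<Rightarrow> nat \<Rightarrow> (real ^ 'n \<Rightarrow> complex) \<Rightarrow> real" where
  "test_norm r N \<phi> = (\<Sum>js | length js \<le> N. SUP x\<in>cbox 0 r. cmod (iter_partial js \<phi> x))"

lemma iter_partial_le_test_norm:
  fixes r :: "real ^ 'n"
  assumes \<phi>: "\<phi> \<in> test_functions r" and "length js \<le> N" "x \<in> cbox 0 r"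
  shows "cmod (iter_partial js \<phi> x) \<le> test_norm r N \<phi>"
proof -
  have bdd: "bdd_above ((\<lambda>x. cmod (iter_partial js \<phi> x)) ` cbox 0 r)" for js
    by (intro bounded_imp_bdd_above compact_imp_bounded compact_continuous_image
        continuous_on_norm test_functions_continuous[OF \<phi>] compact_cbox)
  have le: "cmod (iter_partial js \<phi> x) \<le> (SUP x\<in>cbox 0 r. cmod (iter_partial js \<phi> x))" for js
    by (rule cSUP_upper[OF assms(3) bdd])
  have fin: "finite {js :: 'n list. length js \<le> N}"
    using finite_lists_length_le[of "UNIV :: 'n set" N] by simp
  have "(SUP x\<in>cbox 0 r. cmod (iter_partial js \<phi> x)) \<le> test_norm r N \<phi>"
    unfolding test_norm_def
    by (rule member_le_sum[OF _ _ fin]) (use assms(2) in \<open>auto intro: order_trans[OF norm_ge_zero le]\<close>)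
  then show ?thesis using le[of js] by simp
qed

lemma test_norm_nonneg:
  fixes r :: "real ^ 'n"
  assumes r: "\<forall>i. r $ i > 0" and \<phi>: "\<phi> \<in> test_functions r"
  shows "test_norm r N \<phi> \<ge> 0"
proof -
  have "0 \<in> cbox 0 r" using r by (auto simp: mem_box_cart less_imp_le)
  from iter_partial_le_test_norm[OF \<phi> _ this, of "[]" N] show ?thesis
    by (metis le0 list.size(3) norm_ge_zero order_trans)
qed

text \<open>Each partial derivative of the test function pulls out one factor of the frequency in
  modulus, and modes have modulus 1.\<close>

lemma mode_pairing_le:
  fixes r :: "real ^ 'n"
  assumes r: "\<forall>i. r $ i > 0" and \<phi>: "\<phi> \<in> test_functions r" and "m \<le> N"
  shows "\<bar>freq r k $ i\<bar> ^ m * cmod (mode_pairing r k \<phi>) \<le> test_norm r N \<phi> * measure lborel (cbox 0 r)"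
proof -
  have "cmod (mode_pairing r k (iter_partial (replicate m i) \<phi>)) =
      \<bar>freq r k $ i\<bar> ^ m * cmod (mode_pairing r k \<phi>)"
  proof (induction m)
    case (Suc m)
    have "iter_partial (replicate (Suc m) i) \<phi> = partial_deriv i (iter_partial (replicate m i) \<phi>)"
      by (simp add: iter_partial_def)
    then show ?case
      using Suc iter_partial_replicate_test_functions[OF \<phi>]
      by (simp add: mode_pairing_partial_deriv[OF r] norm_mult mult_ac)
  qed (simp add: iter_partial_def)
  moreover have "cmod (mode_pairing r k (iter_partial (replicate m i) \<phi>)) \<le>
      test_norm r N \<phi> * measure lborel (cbox 0 r)"
    unfolding mode_pairing_def
  proof (rule has_integral_bound)
    show "((\<lambda>x. mode r k x * iter_partial (replicate m i) \<phi> x) has_integral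
        integral (cbox 0 r) (\<lambda>x. mode r k x * iter_partial (replicate m i) \<phi> x)) (cbox 0 r)"
      by (intro integrable_integral integrable_continuous continuous_intros
          test_functions_continuous[OF \<phi>])
    show "cmod (mode r k x * iter_partial (replicate m i) \<phi> x) \<le> test_norm r N \<phi>"
      if "x \<in> cbox 0 r" for x
      using iter_partial_le_test_norm[OF \<phi> _ that] assms(3) by (simp add: norm_mult)
  qed (rule test_norm_nonneg[OF r \<phi>])
  ultimately show ?thesis by simp
qed

lemma freq_ge:
  fixes r :: "real ^ 'n"
  assumes r: "\<forall>i. r $ i > 0"
  shows "\<bar>freq r k $ i\<bar> \<ge> 2 * pi / norm r * \<bar>real_of_int (k $ i)\<bar>"
proof -
  have "r $ i \<le> norm r" "r $ i > 0" using component_le_norm_cart[of r i] r by auto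
  then have "2 * pi * \<bar>real_of_int (k $ i)\<bar> / norm r \<le> 2 * pi * \<bar>real_of_int (k $ i)\<bar> / r $ i"
    by (intro divide_left_mono mult_pos_pos) (auto simp: less_le_trans)
  also have "\<dots> = \<bar>freq r k $ i\<bar>"
    using \<open>r $ i > 0\<close> by (simp add: freq_def abs_mult)
  finally show ?thesis by (simp add: mult_ac)
qed

lemma norm_period_pos:
  fixes r :: "real ^ 'n"
  assumes r: "\<forall>i. r $ i > 0"
  shows "norm r > 0"
  using r by (metis norm_le_zero_iff not_less order_less_irrefl zero_index)

text \<open>
  Integrating by parts in the direction of the largest component of \<open>k\<close> gains the full weight.
\<close>

lemma mode_pairing_decay:
  fixes r :: "real ^ 'n"
  assumes r: "\<forall>i. r $ i > 0"
  shows "\<exists>C\<ge>0. \<forall>k. \<forall>\<phi>\<in>test_functions r.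
    lattice_weight k ^ M * cmod (mode_pairing r k \<phi>) \<le> C * test_norm r (2 * M) \<phi>"
proof -
  \<comment> \<open>The denominator comes from bounding the weight by \<open>1 + n\<close> times the
    square of the largest component of \<open>k\<close>, the numerator from
    \<open>freq_ge\<close>.\<close>
  define d where "d = (2 * pi / norm r)\<^sup>2 / (1 + real CARD('n))"
  define V where "V = measure lborel (cbox 0 r)"
  have d: "d > 0" using norm_period_pos[OF r] by (simp add: d_def)
  have V: "V \<ge> 0" by (simp add: V_def)
  \<comment> \<open>The two summands of the constant serve \<open>k = 0\<close> and
    \<open>k \<noteq> 0\<close> respectively.\<close>
  have "lattice_weight k ^ M * cmod (mode_pairing r k \<phi>) \<le> (V + V / d ^ M) * test_norm r (2 * M) \<phi>"
    if \<phi>: "\<phi> \<in> test_functions r" for k \<phi>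
  proof (cases "k = 0")
    case True
    have "lattice_weight k ^ M * cmod (mode_pairing r k \<phi>) \<le> V * test_norm r (2 * M) \<phi>"
      using mode_pairing_le[OF r \<phi>, of 0 "2 * M" k] True
      by (simp add: V_def mult.commute lattice_weight_eq)
    also have "\<dots> \<le> (V + V / d ^ M) * test_norm r (2 * M) \<phi>"
      using d V by (intro mult_right_mono test_norm_nonneg[OF r \<phi>]) auto
    finally show ?thesis .
  next
    case False
    obtain i where i: "\<And>j. \<bar>k $ j\<bar> \<le> \<bar>k $ i\<bar>"
      using Max_in[of "range (\<lambda>j. \<bar>k $ j\<bar>)"] Max_ge[of "range (\<lambda>j. \<bar>k $ j\<bar>)"] by fastforce
    obtain j where "k $ j \<noteq> 0" using False by (auto simp: vec_eq_iff)
    then have "1 \<le> \<bar>k $ i\<bar>" using i[of j] by linarith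
    then have "1 \<le> \<bar>real_of_int (k $ i)\<bar>" by linarith
    then have "1 \<le> (real_of_int (k $ i))\<^sup>2" by (metis abs_le_square_iff abs_one one_power2)
    moreover have "(real_of_int (k $ j))\<^sup>2 \<le> (real_of_int (k $ i))\<^sup>2" for j
      using i[of j] by (intro iffD1[OF abs_le_square_iff]) linarith
    then have "(\<Sum>j\<in>UNIV. (real_of_int (k $ j))\<^sup>2) \<le> (\<Sum>j\<in>(UNIV :: 'n set). (real_of_int (k $ i))\<^sup>2)"
      by (intro sum_mono)
    ultimately have "lattice_weight k \<le> (1 + real CARD('n)) * (real_of_int (k $ i))\<^sup>2"
      unfolding lattice_weight_eq by (simp add: algebra_simps)
    then have "d * lattice_weight k \<le> d * ((1 + real CARD('n)) * (real_of_int (k $ i))\<^sup>2)"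
      using d by simp
    also have "\<dots> = (2 * pi / norm r * \<bar>real_of_int (k $ i)\<bar>)\<^sup>2"
      by (simp add: d_def power_mult_distrib power_divide add_pos_nonneg)
    also have "\<dots> \<le> \<bar>freq r k $ i\<bar>\<^sup>2"
      by (intro power_mono freq_ge[OF r]) auto
    finally have "(d * lattice_weight k) ^ M \<le> (\<bar>freq r k $ i\<bar>\<^sup>2) ^ M"
      using d lattice_weight_pos[of k] by (intro power_mono) auto
    then have "(d * lattice_weight k) ^ M * cmod (mode_pairing r k \<phi>) \<le>
        \<bar>freq r k $ i\<bar> ^ (2 * M) * cmod (mode_pairing r k \<phi>)"
      by (intro mult_right_mono) (auto simp: power_mult)
    also have "\<dots> \<le> test_norm r (2 * M) \<phi> * V"
      unfolding V_def by (rule mode_pairing_le[OF r \<phi>]) simp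
    finally have "lattice_weight k ^ M * cmod (mode_pairing r k \<phi>) \<le> V / d ^ M * test_norm r (2 * M) \<phi>"
      using d by (simp add: field_simps power_mult_distrib)
    also have "\<dots> \<le> (V + V / d ^ M) * test_norm r (2 * M) \<phi>"
      using d V by (intro mult_right_mono test_norm_nonneg[OF r \<phi>]) auto
    finally show ?thesis .
  qed
  moreover have "V + V / d ^ M \<ge> 0" using d V by simp
  ultimately show ?thesis by blast
qed

section \<open>Fourier series with polynomially bounded coefficients\<close>

lemma fourier_series_summable:
  fixes r :: "real ^ 'n" and c :: "int ^ 'n \<Rightarrow> complex"
  assumes r: "\<forall>i. r $ i > 0"
    and c: "\<And>k. cmod (c k) \<le> B * lattice_weight k powr p"
  shows "\<exists>D N. \<forall>\<phi>\<in>test_functions r.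
    (\<lambda>k. cmod (c k * mode_pairing r k \<phi>)) summable_on UNIV \<and>
    (\<Sum>\<^sub>\<infinity>k. cmod (c k * mode_pairing r k \<phi>)) \<le> D * test_norm r N \<phi>"
proof -
  obtain q :: nat where q: "p \<le> real q" using real_arch_simple by blast
  \<comment> \<open>The power \<open>q\<close> absorbs the growth of the coefficients; the remaining
    power makes the series over the lattice converge.\<close>
  define M where "M = q + CARD('n)"
  obtain C where C: "C \<ge> 0" "\<And>k \<phi>. \<phi> \<in> test_functions r \<Longrightarrow>
      lattice_weight k ^ M * cmod (mode_pairing r k \<phi>) \<le> C * test_norm r (2 * M) \<phi>"
    using mode_pairing_decay[OF r, of M] by blast
  define S where "S = (\<Sum>\<^sub>\<infinity>k :: int ^ 'n. 1 / lattice_weight k ^ CARD('n))"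
  have B: "B \<ge> 0"
    using order_trans[OF norm_ge_zero c[of 0]] lattice_weight_pos[of "0 :: int ^ 'n"]
    by (simp add: zero_le_mult_iff)
  have "(\<lambda>k. cmod (c k * mode_pairing r k \<phi>)) summable_on UNIV \<and>
    (\<Sum>\<^sub>\<infinity>k. cmod (c k * mode_pairing r k \<phi>)) \<le> (B * C * S) * test_norm r (2 * M) \<phi>"
    if \<phi>: "\<phi> \<in> test_functions r" for \<phi>
  proof -
    let ?K = "B * C * test_norm r (2 * M) \<phi>"
    have le: "cmod (c k * mode_pairing r k \<phi>) \<le> ?K * (1 / lattice_weight k ^ CARD('n))" for k
    proof -
      have w: "lattice_weight k > 0" "lattice_weight k \<ge> 1"
        by (rule lattice_weight_pos, rule lattice_weight_ge_1)
      have "cmod (c k) \<le> B * lattice_weight k ^ q"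
        using c[of k] powr_mono[OF q w(2)] B w by (simp add: powr_realpow mult_left_mono order_trans)
      then have "lattice_weight k ^ CARD('n) * cmod (c k * mode_pairing r k \<phi>) \<le>
          lattice_weight k ^ CARD('n) * ((B * lattice_weight k ^ q) * cmod (mode_pairing r k \<phi>))"
        using w by (intro mult_left_mono) (auto simp: norm_mult intro: mult_right_mono)
      also have "\<dots> = B * (lattice_weight k ^ M * cmod (mode_pairing r k \<phi>))"
        by (simp add: M_def power_add mult_ac)
      also have "\<dots> \<le> B * (C * test_norm r (2 * M) \<phi>)"
        using C(2)[OF \<phi>] B by (intro mult_left_mono) auto
      finally show ?thesis using w by (simp add: field_simps)
    qed
    have sum: "(\<lambda>k :: int ^ 'n. ?K * (1 / lattice_weight k ^ CARD('n))) summable_on UNIV"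
      by (intro summable_on_cmult_right summable_lattice_weight)
    have abs: "(\<lambda>k. cmod (c k * mode_pairing r k \<phi>)) summable_on UNIV"
      by (rule summable_on_comparison_test[OF sum le]) auto
    have "(\<Sum>\<^sub>\<infinity>k. cmod (c k * mode_pairing r k \<phi>)) \<le> (\<Sum>\<^sub>\<infinity>k :: int ^ 'n. ?K * (1 / lattice_weight k ^ CARD('n)))"
      by (rule infsum_mono[OF abs sum le])
    also have "\<dots> = ?K * S"
      unfolding S_def by (rule infsum_cmult_right) (rule summable_lattice_weight)
    finally show ?thesis using abs by (simp add: mult_ac)
  qed
  then show ?thesis by blast
qed

text \<open>Absolute summability permits termwise addition, the seminorm bound gives continuity, and
  orthogonality of the modes recovers the coefficients.\<close>

lemma
  fixes r :: "real ^ 'n" and c :: "int ^ 'n \<Rightarrow> complex"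
  assumes r: "\<forall>i. r $ i > 0"
    and c: "\<And>k. cmod (c k) \<le> B * lattice_weight k powr p"
  shows fourier_series_converges: "fourier_series_converges r c"
    and periodic_distribution_fourier_series: "periodic_distribution r (fourier_series r c)"
    and fourier_coeff_fourier_series: "fourier_coeff r (fourier_series r c) k = c k"
proof -
  obtain D N where DN: "\<And>\<phi>. \<phi> \<in> test_functions r \<Longrightarrow>
      (\<lambda>k. cmod (c k * mode_pairing r k \<phi>)) summable_on UNIV"
      "\<And>\<phi>. \<phi> \<in> test_functions r \<Longrightarrow>
      (\<Sum>\<^sub>\<infinity>k. cmod (c k * mode_pairing r k \<phi>)) \<le> D * test_norm r N \<phi>"
    using fourier_series_summable[OF assms] by blast
  have sum: "(\<lambda>k. c k * mode_pairing r k \<phi>) summable_on UNIV" if "\<phi> \<in> test_functions r" for \<phi>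
    using DN(1)[OF that] by (rule abs_summable_summable)
  then show "fourier_series_converges r c"
    by (simp add: fourier_series_converges_def)
  have int: "(\<lambda>x. mode r k x * \<phi> x) integrable_on cbox 0 r" if "\<phi> \<in> test_functions r" for \<phi> k
    by (intro integrable_continuous continuous_intros test_functions_continuous_fun[OF that])
  show "periodic_distribution r (fourier_series r c)"
    unfolding periodic_distribution_def
  proof (intro conjI ballI allI)
    fix \<phi> \<psi> assume *: "\<phi> \<in> test_functions r" "\<psi> \<in> test_functions r"
    have "mode_pairing r k (\<lambda>x. \<phi> x + \<psi> x) = mode_pairing r k \<phi> + mode_pairing r k \<psi>" for k
      using int[OF *(1)] int[OF *(2)] by (simp add: mode_pairing_def distrib_left integral_add)
    then show "fourier_series r c (\<lambda>x. \<phi> x + \<psi> x) = fourier_series r c \<phi> + fourier_series r c \<psi>"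
      using sum * by (simp add: fourier_series_def distrib_left infsum_add)
  next
    fix \<phi> :: "real ^ 'n \<Rightarrow> complex" and z
    have "mode_pairing r k (\<lambda>x. z * \<phi> x) = z * mode_pairing r k \<phi>" for k
      by (simp add: mode_pairing_def mult.left_commute)
    then show "fourier_series r c (\<lambda>x. z * \<phi> x) = z * fourier_series r c \<phi>"
      by (simp add: fourier_series_def mult.left_commute infsum_cmult_right')
  next
    have "cmod (fourier_series r c \<phi>) \<le> D * test_norm r N \<phi>" if "\<phi> \<in> test_functions r" for \<phi>
      unfolding fourier_series_def
      using norm_infsum_bound[OF DN(1)[OF that]] DN(2)[OF that] by linarith
    then show "\<exists>C N. \<forall>\<phi>\<in>test_functions r. cmod (fourier_series r c \<phi>) \<le>
        C * (\<Sum>js | length js \<le> N. SUP x\<in>cbox 0 r. cmod (iter_partial js \<phi> x))"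
      unfolding test_norm_def by blast
  qed
  have "fourier_series r c (mode r (- k)) = (\<Sum>\<^sub>\<infinity>j\<in>{k}. c j * complex_of_real (\<Prod>i\<in>UNIV. r $ i))"
    unfolding fourier_series_def by (rule infsum_cong_neutral) (auto simp: mode_pairing_mode[OF r])
  moreover have "(\<Prod>i\<in>UNIV. r $ i) \<noteq> 0"
    using r by (simp add: less_imp_neq[symmetric])
  ultimately show "fourier_coeff r (fourier_series r c) k = c k"
    by (simp add: fourier_coeff_def del: of_real_prod)
qed

lemma sobolev_iff:
  "h \<in> sobolev r s \<longleftrightarrow> periodic_distribution r h \<and>
    (\<lambda>k. lattice_weight k powr s * (cmod (fourier_coeff r h k))\<^sup>2) summable_on UNIV"
  by (simp add: sobolev_def lattice_weight_def)

text \<open>A single term of the weighted sum is at most the whole sum, so the coefficients grow at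
  most polynomially and the preceding facts apply.\<close>

lemma fourier_series_sobolev:
  fixes r :: "real ^ 'n" and c :: "int ^ 'n \<Rightarrow> complex"
  assumes r: "\<forall>i. r $ i > 0"
    and c: "(\<lambda>k. lattice_weight k powr q * (cmod (c k))\<^sup>2) summable_on UNIV"
  shows "fourier_series_converges r c \<and> fourier_series r c \<in> sobolev r q"
proof -
  define S where "S = (\<Sum>\<^sub>\<infinity>k. lattice_weight k powr q * (cmod (c k))\<^sup>2)"
  have "cmod (c k) \<le> sqrt S * lattice_weight k powr (- q / 2)" for k
  proof -
    let ?w = "lattice_weight k"
    have w: "?w > 0" by (rule lattice_weight_pos)
    have "(\<Sum>k\<in>{k}. lattice_weight k powr q * (cmod (c k))\<^sup>2) \<le> S"
      unfolding S_def by (rule finite_sum_le_infsum[OF c]) auto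
    then have "?w powr q * (cmod (c k))\<^sup>2 \<le> S" by simp
    then have "(?w powr (q / 2) * cmod (c k))\<^sup>2 \<le> S"
      by (simp add: power_mult_distrib power2_eq_square[of "?w powr _"] flip: powr_add)
    then have "?w powr (q / 2) * cmod (c k) \<le> sqrt S"
      by (rule real_le_rsqrt)
    then show ?thesis
      using w by (simp add: powr_minus field_simps)
  qed
  note * = this
  show ?thesis
    using fourier_series_converges[OF r *] periodic_distribution_fourier_series[OF r *]
      fourier_coeff_fourier_series[OF r *] c
    by (simp add: sobolev_iff)
qed

text \<open>The gain is \<open>2 * p\<close> and not \<open>p\<close> because
  \<open>sobolev r s\<close> puts the power \<open>s\<close> of the weight on the squared
  coefficient, so the bound on \<open>\<mu>\<close> enters squared.\<close>

lemma fourier_multiplier_sobolev: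
  fixes r :: "real ^ 'n" and c \<mu> :: "int ^ 'n \<Rightarrow> complex"
  assumes r: "\<forall>i. r $ i > 0" and b: "b \<in> sobolev r s"
    and c: "\<And>k. c k = \<mu> k * fourier_coeff r b k"
    and \<mu>: "\<And>k. cmod (\<mu> k) * lattice_weight k powr p \<le> K"
  shows "fourier_series_converges r c \<and> fourier_series r c \<in> sobolev r (s + 2 * p)"
proof (rule fourier_series_sobolev[OF r])
  have sum: "(\<lambda>k. K\<^sup>2 * (lattice_weight k powr s * (cmod (fourier_coeff r b k))\<^sup>2)) summable_on UNIV"
    using b by (intro summable_on_cmult_right) (simp add: sobolev_iff)
  show "(\<lambda>k. lattice_weight k powr (s + 2 * p) * (cmod (c k))\<^sup>2) summable_on UNIV"
  proof (rule summable_on_comparison_test[OF sum])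
    fix k :: "int ^ 'n"
    let ?w = "lattice_weight k"
    have "(cmod (\<mu> k) * ?w powr p)\<^sup>2 \<le> K\<^sup>2"
      using \<mu>[of k] by (intro power_mono) auto
    then have "(cmod (\<mu> k) * ?w powr p)\<^sup>2 * (?w powr s * (cmod (fourier_coeff r b k))\<^sup>2) \<le>
        K\<^sup>2 * (?w powr s * (cmod (fourier_coeff r b k))\<^sup>2)"
      by (intro mult_right_mono) auto
    moreover have "?w powr (s + 2 * p) = ?w powr s * (?w powr p)\<^sup>2"
      by (simp add: power2_eq_square flip: powr_add)
    ultimately show "?w powr (s + 2 * p) * (cmod (c k))\<^sup>2 \<le>
        K\<^sup>2 * (?w powr s * (cmod (fourier_coeff r b k))\<^sup>2)"
      by (simp add: c norm_mult power_mult_distrib mult_ac)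
  qed auto
qed

text \<open>Transfers lower bounds in \<open>1 + z\<close> to the lattice weight; the multiplier
  estimates use \<open>\<kappa> = \<delta>\<^sup>2 / 4\<close>.\<close>

lemma one_plus_freq_ge:
  fixes r :: "real ^ 'n"
  assumes r: "\<forall>i. r $ i > 0" and "\<kappa> > 0"
  shows "\<exists>d>0. \<forall>k. 1 + \<kappa> * (norm (freq r k))\<^sup>2 \<ge> d * lattice_weight k"
proof -
  define e where "e = \<kappa> * (2 * pi / norm r)\<^sup>2"
  have e: "e > 0" using norm_period_pos[OF r] assms by (simp add: e_def)
  have "1 + \<kappa> * (norm (freq r k))\<^sup>2 \<ge> min 1 e * lattice_weight k" for k :: "int ^ 'n"
  proof -
    have "norm ((2 * pi / norm r) *\<^sub>R (\<chi> i. real_of_int (k $ i))) \<le> norm (freq r k)"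
      using freq_ge[OF r, of k] by (intro norm_le_componentwise_cart) (simp add: abs_mult)
    then have "((2 * pi / norm r) * norm (\<chi> i. real_of_int (k $ i)))\<^sup>2 \<le> (norm (freq r k))\<^sup>2"
      by (intro power_mono) auto
    then have "\<kappa> * ((2 * pi / norm r) * norm (\<chi> i. real_of_int (k $ i)))\<^sup>2 \<le> \<kappa> * (norm (freq r k))\<^sup>2"
      using assms(2) by (intro mult_left_mono) auto
    then have "e * (norm (\<chi> i. real_of_int (k $ i)))\<^sup>2 \<le> \<kappa> * (norm (freq r k))\<^sup>2"
      unfolding e_def power_mult_distrib by (simp only: mult.assoc)
    moreover have "min 1 e * (norm (\<chi> i. real_of_int (k $ i)))\<^sup>2 \<le> e * (norm (\<chi> i. real_of_int (k $ i)))\<^sup>2"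
      by (intro mult_right_mono) auto
    moreover have "min 1 e \<le> 1" by simp
    ultimately show ?thesis unfolding lattice_weight_def distrib_left by linarith
  qed
  then show ?thesis using e by (intro exI[of _ "min 1 e"]) auto
qed

section \<open>Regularity of the solutions\<close>

lemma multiplier_bounded_above:
  assumes "\<delta> > 0" "\<beta> < real CARD('n) + 4"
  shows "\<exists>A\<ge>0. \<forall>\<nu> :: real ^ 'n. multiplier \<delta> \<beta> \<nu> \<le> A"
proof -
  let ?a = "(real CARD('n) + 2 - \<beta>) / 2" and ?c = "real CARD('n) / 2"
  have "?a > - 1" "?c \<ge> 1 / 2" using assms by (auto simp: Suc_leI)
  then obtain A where A: "\<And>z. z \<ge> 0 \<Longrightarrow> symbol ?a ?c z \<ge> - A"
    using symbol_bounded_below by metis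
  have "multiplier \<delta> \<beta> \<nu> \<le> max 0 (4 / \<delta>\<^sup>2 * A)" for \<nu> :: "real ^ 'n"
  proof -
    have "4 / \<delta>\<^sup>2 * - A \<le> 4 / \<delta>\<^sup>2 * symbol ?a ?c ((norm \<nu>)\<^sup>2 * \<delta>\<^sup>2 / 4)"
      by (intro mult_left_mono A) auto
    then show ?thesis by (simp add: multiplier_eq_symbol[OF assms])
  qed
  then show ?thesis by (intro exI[of _ "max 0 (4 / \<delta>\<^sup>2 * A)"]) auto
qed

text \<open>The condition \<open>\<beta> > n\<close> means \<open>a < 1\<close>, and
  \<open>1 - a = (\<beta> - n) / 2\<close> is the growth exponent of the symbol.\<close>

lemma multiplier_le_powr:
  fixes r :: "real ^ 'n"
  assumes r: "\<forall>i. r $ i > 0" and \<delta>: "\<delta> > 0" and \<beta>: "\<beta> < real CARD('n) + 4" "\<beta> > real CARD('n)"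
  shows "\<exists>C>0. \<exists>A\<ge>0. \<forall>k. multiplier \<delta> \<beta> (freq r k) \<le>
    A - C * lattice_weight k powr ((\<beta> - real CARD('n)) / 2)"
proof -
  let ?a = "(real CARD('n) + 2 - \<beta>) / 2" and ?c = "real CARD('n) / 2"
  let ?p = "(\<beta> - real CARD('n)) / 2"
  have p: "1 - ?a = ?p" by (simp add: field_simps)
  have "?a > - 1" "?a < 1" "?c \<ge> 1 / 2" using \<beta> by (auto simp: Suc_leI)
  then obtain C A where C: "C > 0" and A: "\<And>z. z \<ge> 0 \<Longrightarrow> symbol ?a ?c z \<ge> C * (1 + z) powr ?p - A"
    using symbol_ge_powr unfolding p[symmetric] by metis
  obtain d where d: "d > 0" "\<And>k. 1 + \<delta>\<^sup>2 / 4 * (norm (freq r k))\<^sup>2 \<ge> d * lattice_weight k"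
    using one_plus_freq_ge[OF r, of "\<delta>\<^sup>2 / 4"] \<delta> by auto
  let ?C = "4 / \<delta>\<^sup>2 * C * d powr ?p"
  have "multiplier \<delta> \<beta> (freq r k) \<le> max 0 (4 / \<delta>\<^sup>2 * A) - ?C * lattice_weight k powr ?p" for k
  proof -
    let ?z = "(norm (freq r k))\<^sup>2 * \<delta>\<^sup>2 / 4"
    have "(d * lattice_weight k) powr ?p \<le> (1 + ?z) powr ?p"
      using d lattice_weight_pos[of k] \<beta> by (intro powr_mono2) (auto simp: mult_ac)
    then have "C * (d powr ?p * lattice_weight k powr ?p) \<le> C * (1 + ?z) powr ?p"
      using C by (simp add: powr_mult)
    then have "C * (d powr ?p * lattice_weight k powr ?p) - A \<le> symbol ?a ?c ?z"
      using A[of ?z] by simp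
    then have "4 / \<delta>\<^sup>2 * (C * (d powr ?p * lattice_weight k powr ?p) - A) \<le> 4 / \<delta>\<^sup>2 * symbol ?a ?c ?z"
      by (intro mult_left_mono) auto
    then show ?thesis
      unfolding multiplier_eq_symbol[OF \<delta> \<beta>(1)] by (simp add: algebra_simps)
  qed
  moreover have "?C > 0" using C d \<delta> by simp
  ultimately show ?thesis by (intro exI[of _ ?C] conjI exI[of _ "max 0 (4 / \<delta>\<^sup>2 * A)"]) auto
qed

text \<open>Here \<open>a = 1\<close>. The factor of the logarithm is
  \<open>4 / \<delta>\<^sup>2\<close> times \<open>c = n / 2\<close>; it determines the rate at
  which \<open>V\<close> gains regularity in time.\<close>

lemma multiplier_le_ln:
  fixes r :: "real ^ 'n"
  assumes r: "\<forall>i. r $ i > 0" and \<delta>: "\<delta> > 0"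
  shows "\<exists>A. \<forall>k. multiplier \<delta> (real CARD('n)) (freq r k) \<le>
    A - 2 * real CARD('n) / \<delta>\<^sup>2 * ln (lattice_weight k)"
proof -
  let ?c = "real CARD('n) / 2"
  have c: "?c \<ge> 1 / 2" by (auto simp: Suc_leI)
  then obtain A where A: "\<And>z. z \<ge> 0 \<Longrightarrow> symbol 1 ?c z \<ge> ?c * ln (1 + z) - A"
    using symbol_1_ge_ln by metis
  obtain d where d: "d > 0" "\<And>k. 1 + \<delta>\<^sup>2 / 4 * (norm (freq r k))\<^sup>2 \<ge> d * lattice_weight k"
    using one_plus_freq_ge[OF r, of "\<delta>\<^sup>2 / 4"] \<delta> by auto
  have "multiplier \<delta> (real CARD('n)) (freq r k) \<le>
      4 / \<delta>\<^sup>2 * (A - ?c * ln d) - 2 * real CARD('n) / \<delta>\<^sup>2 * ln (lattice_weight k)" for k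
  proof -
    let ?z = "(norm (freq r k))\<^sup>2 * \<delta>\<^sup>2 / 4"
    have "ln (d * lattice_weight k) \<le> ln (1 + ?z)"
      using d lattice_weight_pos[of k] by (intro ln_mono) (auto simp: mult_ac)
    then have "?c * (ln d + ln (lattice_weight k)) \<le> ?c * ln (1 + ?z)"
      using d lattice_weight_pos[of k] by (simp add: ln_mult)
    moreover have "?c * ln (1 + ?z) - A \<le> symbol 1 ?c ?z"
      by (rule A) simp
    ultimately have "?c * (ln d + ln (lattice_weight k)) - A \<le> symbol 1 ?c ?z"
      by linarith
    then have "4 / \<delta>\<^sup>2 * (?c * (ln d + ln (lattice_weight k)) - A) \<le> 4 / \<delta>\<^sup>2 * symbol 1 ?c ?z"
      by (intro mult_left_mono) auto
    moreover have "4 / \<delta>\<^sup>2 * (?c * (ln d + ln (lattice_weight k)) - A) =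
        2 * real CARD('n) / \<delta>\<^sup>2 * ln (lattice_weight k) - 4 / \<delta>\<^sup>2 * (A - ?c * ln d)"
      by (simp add: algebra_simps)
    moreover have "multiplier \<delta> (real CARD('n)) (freq r k) = - (4 / \<delta>\<^sup>2 * symbol 1 ?c ?z)"
      using multiplier_eq_symbol[OF \<delta>, of "real CARD('n)" "freq r k"] by simp
    ultimately show ?thesis by linarith
  qed
  then show ?thesis by blast
qed

section \<open>Elementary exponential estimates\<close>

text \<open>For \<open>x \<noteq> 0\<close> the quotient is the integral of exp(x \<tau>) over
  \<tau> from 0 to \<open>t\<close>; the proof uses only \<open>exp y \<ge> 1 + y\<close>. At
  \<open>x = 0\<close> division by zero gives 0.\<close>

lemma abs_exp_quotient_le:
  fixes x t A :: real
  assumes "t \<ge> 0" "x \<le> A" "A \<ge> 0"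
  shows "\<bar>(exp (x * t) - 1) / x\<bar> \<le> t * exp (A * t)"
proof (cases x "0 :: real" rule: linorder_cases)
  case greater
  have "1 - x * t \<le> exp (- (x * t))"
    using exp_ge_add_one_self[of "- (x * t)"] by simp
  then have "(1 - x * t) * exp (x * t) \<le> exp (- (x * t)) * exp (x * t)"
    by (rule mult_right_mono) simp
  then have "exp (x * t) - 1 \<le> x * (t * exp (x * t))"
    by (simp add: algebra_simps flip: exp_add)
  also have "\<dots> \<le> x * (t * exp (A * t))"
    using assms greater by (intro mult_left_mono) (auto intro: mult_right_mono)
  finally have "(exp (x * t) - 1) / x \<le> t * exp (A * t)"
    using greater by (simp add: field_simps)
  then show ?thesis using greater assms by simp
next
  case less
  have "x * t \<le> 0" using less assms by (simp add: mult_nonpos_nonneg)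
  then have "\<bar>(exp (x * t) - 1) / x\<bar> = (1 - exp (x * t)) / (- x)"
    using less by (simp add: abs_divide)
  also have "\<dots> \<le> t"
    using less exp_ge_add_one_self[of "x * t"] by (simp add: field_simps)
  also have "\<dots> \<le> t * exp (A * t)"
    using assms by (simp add: mult_le_cancel_left1)
  finally show ?thesis .
qed (use assms in simp)

lemma powr_mult_exp_bounded:
  fixes D p P :: real
  assumes "D > 0" "p > 0"
  shows "\<exists>K. \<forall>w\<ge>1. exp (- (D * w powr p)) * w powr P \<le> K"
proof -
  \<comment> \<open>Chosen so that \<open>P \<le> L * p\<close>; the added 1 keeps \<open>L\<close>
    positive when \<open>P = 0\<close>. The bound then follows from \<open>ln y \<le> y - 1\<close>
    at \<open>y = w powr p * D / L\<close>.\<close>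
  define L where "L = \<bar>P\<bar> / p + 1"
  have "\<bar>P\<bar> / p \<ge> 0" using assms by simp
  then have L: "L > 0" by (simp add: L_def)
  have "P \<le> L * p" using assms by (simp add: L_def distrib_right)
  have "exp (- (D * w powr p)) * w powr P \<le> exp (- L - L * ln (D / L))" if w: "w \<ge> 1" for w
  proof -
    have "ln (w powr p * (D / L)) \<le> w powr p * (D / L) - 1"
      using assms L w by (intro ln_le_minus_one) auto
    moreover have "ln (w powr p * (D / L)) = p * ln w + ln (D / L)"
      using assms L w by (subst ln_mult) (auto simp: ln_powr)
    ultimately have "L * (p * ln w + ln (D / L)) \<le> L * (w powr p * (D / L) - 1)"
      using L by (intro mult_left_mono) auto
    also have "\<dots> = D * w powr p - L" using L by (simp add: field_simps)
    finally have "L * p * ln w \<le> D * w powr p - L - L * ln (D / L)"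
      by (simp add: algebra_simps)
    moreover have "P * ln w \<le> L * p * ln w"
      using \<open>P \<le> L * p\<close> w by (intro mult_right_mono) auto
    moreover have "exp (- (D * w powr p)) * w powr P = exp (P * ln w - D * w powr p)"
      using w by (simp add: powr_def flip: exp_add)
    ultimately show ?thesis by simp
  qed
  then show ?thesis by blast
qed

theorem theorem9:
  fixes r :: "real ^ 'n"
    and \<delta> \<beta> \<epsilon>\<^sub>1 s :: real
    and b :: "(real ^ 'n \<Rightarrow> complex) \<Rightarrow> complex"
  defines "n \<equiv> real CARD('n)"
  defines "U \<equiv> \<lambda>t. fourier_series r (U_coeff r \<delta> \<beta> b t)"
  defines "V \<equiv> \<lambda>t. fourier_series r (V_coeff r \<delta> \<beta> b t)"
  assumes "\<forall>i. r $ i > 0"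
    and "\<delta> > 0"
    and "\<beta> < n + 4"
    and "\<epsilon>\<^sub>1 > 0"
    and "b \<in> sobolev r s"
  shows "(\<forall>t\<ge>0. fourier_series_converges r (U_coeff r \<delta> \<beta> b t) \<and>
                 fourier_series_converges r (V_coeff r \<delta> \<beta> b t)) \<and>
         (\<forall>t>0. U t \<in> sobolev r (if \<beta> \<le> n then s else s + \<beta> - n) \<and>
                V t \<in> (if \<beta> < n then sobolev r s
                       else if \<beta> = n then sobolev r (s + 4 * n * t / \<delta>\<^sup>2 * (1 - \<epsilon>\<^sub>1))
                       else sobolev_infinity r))"
proof -
  note r = assms(4) and \<delta> = assms(5) and \<beta> = assms(6)[unfolded n_def]
  let ?m = "\<lambda>k. multiplier \<delta> \<beta> (freq r k)"
  let ?u = "\<lambda>t k. if k = 0 then t else (exp (?m k * t) - 1) / ?m k"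
  \<comment> \<open>This fact and the next reduce every claim to a bound on a scalar multiplier;
    \<open>p = 0\<close> yields convergence and the plain index \<open>s\<close>.\<close>
  have U_mult: "fourier_series_converges r (U_coeff r \<delta> \<beta> b t) \<and> U t \<in> sobolev r (s + 2 * p)"
    if "\<And>k. \<bar>?u t k\<bar> * lattice_weight k powr p \<le> K" for t p K
    unfolding U_def
    by (rule fourier_multiplier_sobolev[OF r assms(8), of _ "\<lambda>k. complex_of_real (?u t k)" p K])
      (simp add: U_coeff_def, use that in simp)
  have V_mult: "fourier_series_converges r (V_coeff r \<delta> \<beta> b t) \<and> V t \<in> sobolev r (s + 2 * p)"
    if "\<And>k. exp (?m k * t) * lattice_weight k powr p \<le> K" for t p K
    unfolding V_def
    by (rule fourier_multiplier_sobolev[OF r assms(8), of _ "\<lambda>k. complex_of_real (exp (?m k * t))" p K])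
      (simp add: V_coeff_def, use that in simp)

  obtain A where A: "A \<ge> 0" "\<And>k. ?m k \<le> A"
    using multiplier_bounded_above[OF \<delta> \<beta>] by blast
  have u_le: "\<bar>?u t k\<bar> \<le> t * exp (A * t)" if "t \<ge> 0" for t k
    using abs_exp_quotient_le[OF that A(2) A(1)] that A(1) by (simp add: mult_le_cancel_left1)
  have U0: "fourier_series_converges r (U_coeff r \<delta> \<beta> b t) \<and> U t \<in> sobolev r s" if "t \<ge> 0" for t
    using U_mult[of t 0 "t * exp (A * t)"] u_le[OF that] by (simp del: powr_zero_eq_one)
  have V0: "fourier_series_converges r (V_coeff r \<delta> \<beta> b t) \<and> V t \<in> sobolev r s" if "t \<ge> 0" for t
    using V_mult[of t 0 "exp (A * t)"] that A(2) by (simp del: powr_zero_eq_one add: mult_right_mono)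

  have U1: "U t \<in> sobolev r (s + \<beta> - n)" if t: "t > 0" and \<beta>n: "\<beta> > n" for t
  proof -
    let ?p = "(\<beta> - n) / 2"
    obtain C B where C: "C > 0" "B \<ge> 0" "\<And>k. ?m k \<le> B - C * lattice_weight k powr ?p"
      using multiplier_le_powr[OF r \<delta> \<beta>] \<beta>n unfolding n_def by blast
    \<comment> \<open>The term \<open>2 / C\<close> serves large frequencies, where the multiplier
      is at most \<open>- C * ?w / 2\<close>. Elsewhere \<open>?w\<close> is at most
      \<open>2 * B / C\<close>, or 1 when \<open>k = 0\<close>, and the crude bound
      \<open>u_le\<close> suffices.\<close>
    have *: "\<bar>?u t k\<bar> * lattice_weight k powr ?p \<le> 2 / C + t * exp (A * t) * (2 * B / C + 1)" for k
    proof -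
      let ?w = "lattice_weight k powr ?p"
      have w: "?w > 0" using lattice_weight_pos[of k] by simp
      show ?thesis
      proof (cases "k \<noteq> 0 \<and> C * ?w \<ge> 2 * B")
        case True
        then have m: "?m k \<le> - (C * ?w / 2)" using C(3)[of k] by simp
        have Cw: "C * ?w / 2 > 0" using C w by simp
        then have neg: "?m k < 0" using m by linarith
        then have "exp (?m k * t) \<le> 1" using t by (simp add: mult_nonpos_nonneg)
        then have "\<bar>?u t k\<bar> = (1 - exp (?m k * t)) / (- ?m k)"
          using True neg by (simp add: abs_divide)
        also have "\<dots> \<le> 1 / (C * ?w / 2)"
          using m Cw by (intro frac_le) auto
        finally have "\<bar>?u t k\<bar> * ?w \<le> 1 / (C * ?w / 2) * ?w"
          using w by (intro mult_right_mono) auto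
        also have "\<dots> = 2 / C" using w C by simp
        also have "\<dots> \<le> 2 / C + t * exp (A * t) * (2 * B / C + 1)"
          using t C by simp
        finally show ?thesis .
      next
        case False
        have "?w \<le> 2 * B / C + 1"
        proof (cases "k = 0")
          case True
          then show ?thesis using C by (simp add: lattice_weight_eq)
        next
          case k: False
          then have "?w \<le> 2 * B / C" using False C by (simp add: field_simps)
          then show ?thesis by simp
        qed
        then have "\<bar>?u t k\<bar> * ?w \<le> t * exp (A * t) * (2 * B / C + 1)"
          using u_le[of t k] t w by (intro mult_mono) auto
        moreover have "2 / C > 0" using C by simp
        ultimately show ?thesis by linarith
      qed
    qed
    have "s + 2 * ?p = s + \<beta> - n" by simp
    then show ?thesis using U_mult[OF *] by metis
  qed

  have V1: "V t \<in> sobolev r (s + 4 * n * t / \<delta>\<^sup>2 * (1 - \<epsilon>\<^sub>1))" if t: "t > 0" and \<beta>n: "\<beta> = n" for t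
  proof -
    obtain B where B: "\<And>k. ?m k \<le> B - 2 * n / \<delta>\<^sup>2 * ln (lattice_weight k)"
      using multiplier_le_ln[OF r \<delta>] \<beta>n unfolding n_def by blast
    let ?p = "2 * n * t / \<delta>\<^sup>2 * (1 - \<epsilon>\<^sub>1)"
    have "exp (?m k * t) * lattice_weight k powr ?p \<le> exp (B * t)" for k
    proof -
      let ?l = "ln (lattice_weight k)"
      have "?l \<ge> 0" using lattice_weight_ge_1[of k] by simp
      then have "2 * n * t / \<delta>\<^sup>2 * \<epsilon>\<^sub>1 * ?l \<ge> 0"
        using t assms(7) by (simp add: n_def)
      moreover have "?m k * t \<le> (B - 2 * n / \<delta>\<^sup>2 * ?l) * t"
        using B t by (intro mult_right_mono) auto
      moreover have "(B - 2 * n / \<delta>\<^sup>2 * ?l) * t = B * t - 2 * n * t / \<delta>\<^sup>2 * ?l"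
        by (simp add: algebra_simps)
      moreover have "?p * ?l = 2 * n * t / \<delta>\<^sup>2 * ?l - 2 * n * t / \<delta>\<^sup>2 * \<epsilon>\<^sub>1 * ?l"
        by (simp add: algebra_simps diff_divide_distrib)
      ultimately have "?m k * t + ?p * ?l \<le> B * t" by linarith
      moreover have "exp (?m k * t) * lattice_weight k powr ?p = exp (?m k * t + ?p * ?l)"
        using lattice_weight_pos[of k] by (simp add: powr_def exp_add)
      ultimately show ?thesis by simp
    qed
    from V_mult[OF this] show ?thesis by (simp add: mult.assoc)
  qed

  have V2: "V t \<in> sobolev_infinity r" if t: "t > 0" and \<beta>n: "\<beta> > n" for t
    unfolding sobolev_infinity_def
  proof
    fix q :: real
    let ?p = "(\<beta> - n) / 2"
    obtain C B where C: "C > 0" "\<And>k. ?m k \<le> B - C * lattice_weight k powr ?p"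
      using multiplier_le_powr[OF r \<delta> \<beta>] \<beta>n unfolding n_def by blast
    \<comment> \<open>With \<open>t > 0\<close> the stretched exponential beats every power of the
      weight; the power \<open>(q - s) / 2\<close> lifts index \<open>s\<close> to the arbitrary
      index \<open>q\<close>.\<close>
    obtain K where K: "\<And>w. w \<ge> 1 \<Longrightarrow> exp (- (C * t * w powr ?p)) * w powr ((q - s) / 2) \<le> K"
      using powr_mult_exp_bounded[of "C * t" ?p "(q - s) / 2"] C t \<beta>n by auto
    have "exp (?m k * t) * lattice_weight k powr ((q - s) / 2) \<le> exp (B * t) * K" for k
    proof -
      let ?w = "lattice_weight k"
      have "?m k * t \<le> (B - C * ?w powr ?p) * t"
        using C t by (intro mult_right_mono) auto
      then have "exp (?m k * t) \<le> exp (B * t + - (C * t * ?w powr ?p))"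
        by (simp add: algebra_simps)
      then have "exp (?m k * t) \<le> exp (B * t) * exp (- (C * t * ?w powr ?p))"
        by (simp only: exp_add)
      then have "exp (?m k * t) * ?w powr ((q - s) / 2) \<le>
          exp (B * t) * exp (- (C * t * ?w powr ?p)) * ?w powr ((q - s) / 2)"
        by (rule mult_right_mono) simp
      also have "\<dots> \<le> exp (B * t) * K"
        using K[OF lattice_weight_ge_1[of k]] by (simp add: mult.assoc)
      finally show ?thesis .
    qed
    from V_mult[OF this] show "V t \<in> sobolev r q" by (simp add: field_simps)
  qed
  show ?thesis
    using U0 V0 U1 V1 V2 by (auto simp: not_le not_less)
qed

end
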